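(* Let $A$ be a finite alphabet and let $\mu$ denote the uniform (Lebesgue) product measure on $A^\omega\times A^\omega$. The set $I=\{(x,y)\in A^\omega\times A^\omega : x \text{ and } y \text{ are finite-state independent}\}$ satisfies $\mu(I)=1$.
   Context: A $k$-automaton is a tuple $\langle Q,A,\delta,I\rangle$ with finite state set $Q$, alphabet $A$, transition relation $\delta\subseteq Q\times(A\cup\{\varepsilon\})^k\times Q$ and set $I$ of initial states. An infinite run is an infinite sequence of consecutive transitions; its label is the componentwise concatenation $\langle x_1,\dots,x_k\rangle$ of the transition labels; it is accepting if it starts in an initial state and every $x_j$ is infinite. A $k$-automaton is $\ell$-deterministic if $I$ is a singleton and, for any two transitions $p\xrightarrow{\alpha_1,\dots,\alpha_k}q$ and $p\xrightarrow{\alpha'_1,\dots,\alpha'_k}q'$ leaving the same state $p$: if $\alpha_j=\varepsilon$ for some $j\le\ell$ then $\alpha'_j=\varepsilon$; and if $\alpha_i=\alpha'_i$ for all $i\le \ell$ then $\alpha_i=\alpha'_i$ for all $i>\ell$ and $q=q'$. Such an automaton realizes a partial function $(A^\omega)^\ell\to(A^\omega)^{k-\ell}$ (the first $\ell$ tapes are inputs, the others outputs). For a $1$-deterministic $2$-automaton $\mathcal T$ and $x=a_1a_2\cdots$ with accepting run $q_0\xrightarrow{a_1|v_1}q_1\xrightarrow{a_2|v_2}\cdots$, $\rho_{\mathcal T}(x)=\liminf_n |v_1\cdots v_n|/n$; it is one-to-one if $x\mapsto\mathcal T(x)$ is injective; $\rho(x)$ is the infimum of $\rho_{\mathcal T}(x)$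 over one-to-one $1$-deterministic $2$-automata. A compressor is a $2$-deterministic $3$-automaton $\mathcal C$ (input tapes carry $x$ and an oracle $y$, third tape is output) such that for every fixed $y$ the map $x\mapsto\mathcal C(x,y)$ is injective. For the unique accepting run $q_0\xrightarrow{\alpha_1,\beta_1|w_1}q_1\xrightarrow{\alpha_2,\beta_2|w_2}\cdots$ with $x=\alpha_1\alpha_2\cdots$, $y=\beta_1\beta_2\cdots$ ($\alpha_i,\beta_i\in A\cup\{\varepsilon\}$), $\rho_{\mathcal C}(x/y)=\liminf_n |w_1\cdots w_n|/|\alpha_1\cdots\alpha_n|$, and $\rho(x/y)$ is the infimum of $\rho_{\mathcal C}(x/y)$ over all compressors. Two infinite words $x,y$ are finite-state independent if $\rho(x/y)=\rho(x)$, $\rho(y/x)=\rho(y)$, $\rho(x)\neq0$ and $\rho(y)\neq0$.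
   Formalization: The alphabet A is assumed to have at least two letters; for a one-letter alphabet the only infinite word has ρ(x)=0, so the set I is empty and the claim fails. *)

theory Defs
  imports "HOL-Probability.Probability" "HOL-Library.Infinite_Set"
begin

text \<open>Automata: state set is a finite subset of nat (any finite state set can be
renamed into nat).  A transition is (p, label, q); a label is a list of length k
over 'a option, None standing for the empty word epsilon.\<close>

record 'a kaut =
  states :: "nat set"
  trans  :: "(nat \<times> 'a option list \<times> nat) set"
  init   :: "nat set"

definition is_kaut :: "nat \<Rightarrow> 'a kaut \<Rightarrow> bool" where
  "is_kaut k M \<longleftrightarrow> finite (states M) \<and> init M \<subseteq> states M \<and>
     (\<forall>p a q. (p, a, q) \<in> trans M \<longrightarrow> p \<in> states M \<and> q \<in> states M \<and> length a = k)"

type_synonym 'a run = "nat \<Rightarrow> nat \<times> 'a option list \<times> nat"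

definition lab :: "nat \<times> 'a option list \<times> nat \<Rightarrow> 'a option list" where
  "lab t = fst (snd t)"

definition is_run :: "'a kaut \<Rightarrow> 'a run \<Rightarrow> bool" where
  "is_run M r \<longleftrightarrow> (\<forall>i. r i \<in> trans M \<and> snd (snd (r i)) = fst (r (Suc i)))"

definition tape_pos :: "'a run \<Rightarrow> nat \<Rightarrow> nat set" where
  "tape_pos r j = {i. lab (r i) ! j \<noteq> None}"

definition tape :: "'a run \<Rightarrow> nat \<Rightarrow> (nat \<Rightarrow> 'a)" where
  "tape r j = (\<lambda>n. the (lab (r (enumerate (tape_pos r j) n)) ! j))"

definition accepting :: "nat \<Rightarrow> 'a kaut \<Rightarrow> 'a run \<Rightarrow> bool" where
  "accepting k M r \<longleftrightarrow> is_run M r \<and> fst (r 0) \<in> init M \<and>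
     (\<forall>j<k. infinite (tape_pos r j))"

text \<open>l-deterministic k-automaton (tapes indexed 0..k-1; the first l are inputs).\<close>
definition l_det :: "nat \<Rightarrow> nat \<Rightarrow> 'a kaut \<Rightarrow> bool" where
  "l_det k l M \<longleftrightarrow> is_kaut k M \<and> (\<exists>q. init M = {q}) \<and>
     (\<forall>p a q a' q'. (p, a, q) \<in> trans M \<longrightarrow> (p, a', q') \<in> trans M \<longrightarrow>
        (\<forall>j<l. a ! j = None \<longrightarrow> a' ! j = None) \<and>
        ((\<forall>i<l. a ! i = a' ! i) \<longrightarrow> (\<forall>i. l \<le> i \<and> i < k \<longrightarrow> a ! i = a' ! i) \<and> q = q'))"

definition trans_out :: "'a kaut \<Rightarrow> (nat \<Rightarrow> 'a) \<Rightarrow> (nat \<Rightarrow> 'a) \<Rightarrow> bool" where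
  "trans_out T x y \<longleftrightarrow> (\<exists>r. accepting 2 T r \<and> tape r 0 = x \<and> tape r 1 = y)"

definition one_to_one :: "'a kaut \<Rightarrow> bool" where
  "one_to_one T \<longleftrightarrow> l_det 2 1 T \<and>
     (\<forall>x x' y. trans_out T x y \<and> trans_out T x' y \<longrightarrow> x = x')"

text \<open>rho_T(x) = liminf_n |v_1...v_n| / n, where v_1 ... v_n is the output produced
up to (and including) the transition reading the n-th input letter.\<close>
definition trans_ratio :: "'a run \<Rightarrow> ereal" where
  "trans_ratio r = liminf (\<lambda>m. ereal (real (card {i. i \<le> enumerate (tape_pos r 0) m \<and>
       lab (r i) ! 1 \<noteq> None}) / real (Suc m)))"

definition rho :: "(nat \<Rightarrow> 'a) \<Rightarrow> ereal" where
  "rho x = Inf {trans_ratio r | (T :: 'a kaut) r. one_to_one T \<and> accepting 2 T r \<and> tape r 0 = x}"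

definition comp_out :: "'a kaut \<Rightarrow> (nat \<Rightarrow> 'a) \<Rightarrow> (nat \<Rightarrow> 'a) \<Rightarrow> (nat \<Rightarrow> 'a) \<Rightarrow> bool" where
  "comp_out C x y z \<longleftrightarrow> (\<exists>r. accepting 3 C r \<and> tape r 0 = x \<and> tape r 1 = y \<and> tape r 2 = z)"

definition compressor :: "'a kaut \<Rightarrow> bool" where
  "compressor C \<longleftrightarrow> l_det 3 2 C \<and>
     (\<forall>y x x' z. comp_out C x y z \<and> comp_out C x' y z \<longrightarrow> x = x')"

definition comp_ratio :: "'a run \<Rightarrow> ereal" where
  "comp_ratio r = liminf (\<lambda>n. ereal (real (card {i. i < n \<and> lab (r i) ! 2 \<noteq> None}) /
       real (card {i. i < n \<and> lab (r i) ! 0 \<noteq> None})))"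

definition rho_cond :: "(nat \<Rightarrow> 'a) \<Rightarrow> (nat \<Rightarrow> 'a) \<Rightarrow> ereal" where
  "rho_cond x y = Inf {comp_ratio r | (C :: 'a kaut) r.
      compressor C \<and> accepting 3 C r \<and> tape r 0 = x \<and> tape r 1 = y}"

definition fs_independent :: "(nat \<Rightarrow> 'a) \<Rightarrow> (nat \<Rightarrow> 'a) \<Rightarrow> bool" where
  "fs_independent x y \<longleftrightarrow> rho_cond x y = rho x \<and> rho_cond y x = rho y \<and>
     rho x \<noteq> 0 \<and> rho y \<noteq> 0"

definition unif_words :: "(nat \<Rightarrow> 'a::finite) measure" where
  "unif_words = (\<Pi>\<^sub>M i\<in>(UNIV::nat set). measure_pmf (pmf_of_set (UNIV :: 'a set)))"

end

theory Submission
  imports Defs "HOL-Real_Asymp.Real_Asymp"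
begin

text \<open>
  A transducer is a compressor that ignores its oracle and the copying transducer has ratio 1, so
  \<open>rho_cond x y \<le> rho x \<le> 1\<close> always; it remains to bound the ratio of every single compressor
  \<open>C\<close> from below, as there are only countably many.  Fix the oracle \<open>y\<close>.  Injectivity on infinite
  words forces a prefix of length \<open>n\<close> of the input to be determined by the state, the position on
  the oracle tape and the output written when it has been consumed.  If the oracle position
  is polynomially bounded in \<open>n\<close>, then only about \<open>A^(c n)\<close> of the \<open>A^n\<close> prefixes can be compressed
  to length \<open>c n\<close>, where \<open>A\<close> is the size of the alphabet and \<open>c < 1\<close>, and the Borel-Cantelli lemma
  applies.

  The oracle position is polynomially bounded for almost every \<open>y\<close>: there is a word \<open>s\<close> such that a run
  which reads \<open>s\<close> from the oracle without touching the input never touches the input again, and in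
  almost every \<open>y\<close> the word \<open>s\<close> occurs so often that long stalls would contain it.

  The set in question must also be shown to be measurable.  By determinism a run is a measurable
  function of the inputs, so both ratios are countable infima of measurable functions.
\<close>

subsection \<open>Counting letters along a run\<close>

text \<open>The head position on tape \<open>j\<close> before transition \<open>n\<close>. Cells are
  indexed from 0, so a letter on tape \<open>j\<close> at transition \<open>n\<close> belongs to
  cell \<open>cnt r j n\<close>.\<close>

definition cnt :: "'a run \<Rightarrow> nat \<Rightarrow> nat \<Rightarrow> nat" where
  "cnt r j n = card {i. i < n \<and> lab (r i) ! j \<noteq> None}"

lemma cnt_0 [simp]: "cnt r j 0 = 0"
  by (simp add: cnt_def)

lemma cnt_Suc: "cnt r j (Suc n) = cnt r j n + (if lab (r n) ! j = None then 0 else 1)"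
proof -
  have "{i. i < Suc n \<and> lab (r i) ! j \<noteq> None} =
      (if lab (r n) ! j = None then {} else {n}) \<union> {i. i < n \<and> lab (r i) ! j \<noteq> None}"
    by (auto simp: less_Suc_eq)
  then show ?thesis
    by (simp add: cnt_def)
qed

lemma cnt_mono: "m \<le> n \<Longrightarrow> cnt r j m \<le> cnt r j n"
  by (auto simp: cnt_def intro!: card_mono)

lemma cnt_eq_tape_pos: "cnt r j n = card {i \<in> tape_pos r j. i < n}"
  by (simp add: cnt_def tape_pos_def conj_commute)

lemma cnt_enumerate:
  assumes "infinite (tape_pos r j)"
  shows "cnt r j (enumerate (tape_pos r j) n) = n"
proof -
  have "{i \<in> tape_pos r j. i < enumerate (tape_pos r j) n} = enumerate (tape_pos r j) ` {..<n}"
  proof (intro equalityI subsetI)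
    fix i assume "i \<in> {i \<in> tape_pos r j. i < enumerate (tape_pos r j) n}"
    moreover from this obtain k where "enumerate (tape_pos r j) k = i"
      using enumerate_Ex[OF assms] by auto
    ultimately show "i \<in> enumerate (tape_pos r j) ` {..<n}"
      using assms by auto
  qed (use assms in \<open>auto simp: enumerate_in_set\<close>)
  moreover have "inj_on (enumerate (tape_pos r j)) {..<n}"
    using strict_mono_enumerate[OF assms] by (simp add: strict_mono_imp_inj_on inj_on_subset)
  ultimately show ?thesis
    by (simp add: cnt_eq_tape_pos card_image)
qed

lemma enumerate_cnt:
  assumes "infinite (tape_pos r j)" "i \<in> tape_pos r j"
  shows "enumerate (tape_pos r j) (cnt r j i) = i"
  using assms cnt_enumerate[OF assms(1)] enumerate_Ex by metis

text \<open>Discrete intermediate value argument: a head moves by at most one cell per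
  transition.\<close>

lemma cnt_attained:
  assumes "a \<le> b" "cnt r j a \<le> m" "m \<le> cnt r j b"
  obtains t where "a \<le> t" "t \<le> b" "cnt r j t = m"
proof -
  have "\<exists>t\<ge>a. t \<le> a + d \<and> cnt r j t = m" if "m \<le> cnt r j (a + d)" for d
    using that
  proof (induction d)
    case 0
    then show ?case using assms(2) by (auto intro: exI[of _ a])
  next
    case (Suc d)
    show ?case
    proof (cases "m \<le> cnt r j (a + d)")
      case True
      then show ?thesis using Suc.IH le_Suc_eq by auto
    next
      case False
      then have "cnt r j (a + Suc d) = m"
        using Suc.prems by (simp add: cnt_Suc split: if_splits)
      then show ?thesis by (intro exI[of _ "a + Suc d"]) simp
    qed
  qed
  from this[of "b - a"] that show thesis
    using assms by auto
qed

lemma cnt_unbounded: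
  assumes "infinite (tape_pos r j)"
  shows "\<exists>t. m \<le> cnt r j t"
  using cnt_enumerate[OF assms, of m] by (metis order_refl)

text \<open>A local form of \<open>tape r j = x\<close> that avoids enumerating positions and is
  checked one transition at a time, which suits both grafting and measurability.\<close>

definition spells :: "'a run \<Rightarrow> nat \<Rightarrow> (nat \<Rightarrow> 'a) \<Rightarrow> bool" where
  "spells r j x \<longleftrightarrow> (\<forall>i. lab (r i) ! j \<noteq> None \<longrightarrow> lab (r i) ! j = Some (x (cnt r j i)))"

lemma tape_eq_iff_spells:
  assumes "infinite (tape_pos r j)"
  shows "tape r j = x \<longleftrightarrow> spells r j x"
proof
  assume x: "tape r j = x"
  show "spells r j x"
    unfolding spells_def
  proof (intro allI impI)
    fix i assume i: "lab (r i) ! j \<noteq> None"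
    then have "enumerate (tape_pos r j) (cnt r j i) = i"
      by (intro enumerate_cnt assms) (simp add: tape_pos_def)
    then show "lab (r i) ! j = Some (x (cnt r j i))"
      using i by (auto simp: x[symmetric] tape_def)
  qed
next
  assume s: "spells r j x"
  show "tape r j = x"
  proof
    fix n
    define e where "e = enumerate (tape_pos r j) n"
    have "e \<in> tape_pos r j" "cnt r j e = n"
      using assms by (simp_all add: e_def enumerate_in_set cnt_enumerate)
    then have "lab (r e) ! j = Some (x n)"
      using s by (auto simp: tape_pos_def spells_def)
    then show "tape r j n = x n"
      by (simp add: tape_def e_def)
  qed
qed

subsection \<open>Exchanging the pasts of two runs\<close>

definition graft :: "'a run \<Rightarrow> nat \<Rightarrow> 'a run \<Rightarrow> nat \<Rightarrow> 'a run" where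
  "graft r' t' r t = (\<lambda>i. if i < t' then r' i else r (i - t' + t))"

lemma cnt_graft:
  assumes "cnt r' j t' = cnt r j t"
  shows "cnt (graft r' t' r t) j i = (if i \<le> t' then cnt r' j i else cnt r j (i - t' + t))"
proof (induction i)
  case (Suc i)
  then show ?case using assms
    by (auto simp: cnt_Suc graft_def not_less_eq_eq Suc_diff_le le_Suc_eq split: if_splits)
qed simp

lemma infinite_tape_pos_graft:
  assumes "infinite (tape_pos r j)"
  shows "infinite (tape_pos (graft r' t' r t) j)"
  unfolding infinite_nat_iff_unbounded
proof
  fix m
  obtain n where n: "n > m + t" "n \<in> tape_pos r j"
    using assms unfolding infinite_nat_iff_unbounded by blast
  then have "n - t + t' \<in> tape_pos (graft r' t' r t) j"
    by (auto simp: tape_pos_def graft_def)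
  then show "\<exists>n>m. n \<in> tape_pos (graft r' t' r t) j"
    using n by (intro exI[of _ "n - t + t'"]) auto
qed

text \<open>Before the cut only cells below the common position \<open>cnt r j t\<close> are
  visited, afterwards only cells from it on, so the two words can be spliced there.\<close>

lemma spells_graft:
  assumes "cnt r' j t' = cnt r j t" "spells r' j x'" "spells r j x"
  shows "spells (graft r' t' r t) j (\<lambda>k. if k < cnt r j t then x' k else x k)"
  unfolding spells_def
proof (intro allI impI)
  fix i assume i: "lab (graft r' t' r t i) ! j \<noteq> None"
  show "lab (graft r' t' r t i) ! j = Some (if cnt (graft r' t' r t) j i < cnt r j t
      then x' (cnt (graft r' t' r t) j i) else x (cnt (graft r' t' r t) j i))"
  proof (cases "i < t'")
    case True
    then have "cnt r' j i < cnt r' j t'"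
      using i cnt_mono[of "Suc i" t' r' j] by (auto simp: graft_def cnt_Suc)
    moreover have "cnt (graft r' t' r t) j i = cnt r' j i"
      using True cnt_graft[OF assms(1), of i] by simp
    ultimately show ?thesis
      using True i assms by (auto simp: graft_def spells_def)
  next
    case False
    then have "cnt r j t \<le> cnt r j (i - t' + t)" "cnt (graft r' t' r t) j i = cnt r j (i - t' + t)"
      using assms(1) cnt_mono[of t "i - t' + t" r j] cnt_graft[OF assms(1), of i] by auto
    then show ?thesis
      using False i assms(3) by (auto simp: graft_def spells_def)
  qed
qed

lemma accepting_graft:
  assumes "accepting k M r'" "accepting k M r" "fst (r' t') = fst (r t)"
  shows "accepting k M (graft r' t' r t)"
proof -
  have "graft r' t' r t i \<in> trans M \<and>
      snd (snd (graft r' t' r t i)) = fst (graft r' t' r t (Suc i))" for i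
  proof -
    consider "Suc i < t'" | "Suc i = t'" | "t' \<le> i" by linarith
    then show ?thesis
      using assms by cases (auto simp: accepting_def is_run_def graft_def Suc_diff_le)
  qed
  moreover have "fst (graft r' t' r t 0) \<in> init M"
    using assms by (auto simp: accepting_def graft_def)
  moreover have "\<forall>j<k. infinite (tape_pos (graft r' t' r t) j)"
    using assms(2) by (simp add: accepting_def infinite_tape_pos_graft)
  ultimately show ?thesis
    by (simp add: accepting_def is_run_def)
qed

definition word_prefix :: "(nat \<Rightarrow> 'a) \<Rightarrow> nat \<Rightarrow> 'a list" where
  "word_prefix x n = map x [0..<n]"

lemma word_prefix_eq_iff: "word_prefix x n = word_prefix y n \<longleftrightarrow> (\<forall>i<n. x i = y i)"
  by (auto simp: word_prefix_def)

lemma length_word_prefix [simp]: "length (word_prefix x n) = n"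
  by (simp add: word_prefix_def)

definition computes :: "'a kaut \<Rightarrow> 'a run \<Rightarrow> (nat \<Rightarrow> 'a) \<Rightarrow> (nat \<Rightarrow> 'a) \<Rightarrow> bool" where
  "computes C r x y \<longleftrightarrow> accepting 3 C r \<and> tape r 0 = x \<and> tape r 1 = y"

lemma computes_infinite: "computes C r x y \<Longrightarrow> j < 3 \<Longrightarrow> infinite (tape_pos r j)"
  by (simp add: computes_def accepting_def)

lemma computes_spells:
  assumes "computes C r x y"
  shows "spells r 0 x" "spells r 1 y" "spells r 2 (tape r 2)"
  using assms computes_infinite[OF assms]
  by (auto simp: computes_def simp flip: tape_eq_iff_spells)

text \<open>Two runs of a compressor over the same oracle that meet in the same state, with the same
  output and the same oracle position, can exchange their pasts without changing the output.\<close>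

lemma compressor_prefix_eq:
  assumes C: "compressor C" and r: "computes C r x y" and r': "computes C r' x' y"
    and state: "fst (r' t') = fst (r t)"
    and cnt0: "cnt r' 0 t' = cnt r 0 t" and cnt1: "cnt r' 1 t' = cnt r 1 t"
    and out: "word_prefix (tape r' 2) (cnt r' 2 t') = word_prefix (tape r 2) (cnt r 2 t)"
  shows "word_prefix x' (cnt r 0 t) = word_prefix x (cnt r 0 t)"
proof -
  let ?s = "graft r' t' r t"
  have cnt2: "cnt r' 2 t' = cnt r 2 t"
    using arg_cong[OF out, of length] by simp
  have acc: "accepting 3 C ?s"
    using r r' state by (intro accepting_graft) (auto simp: computes_def)
  have inf: "infinite (tape_pos ?s j)" if "j < 3" for j
    using acc that by (simp add: accepting_def)
  have "spells ?s 0 (\<lambda>k. if k < cnt r 0 t then x' k else x k)"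
    by (intro spells_graft cnt0 computes_spells[OF r] computes_spells[OF r'])
  then have t0: "tape ?s 0 = (\<lambda>k. if k < cnt r 0 t then x' k else x k)"
    using inf by (simp add: tape_eq_iff_spells)
  have "spells ?s 1 (\<lambda>k. if k < cnt r 1 t then y k else y k)"
    by (intro spells_graft cnt1 computes_spells[OF r] computes_spells[OF r'])
  then have t1: "tape ?s 1 = y"
    using inf by (simp add: tape_eq_iff_spells)
  have "spells ?s 2 (\<lambda>k. if k < cnt r 2 t then tape r' 2 k else tape r 2 k)"
    by (intro spells_graft cnt2 computes_spells[OF r] computes_spells[OF r'])
  \<comment> \<open>The outputs written before the cut coincide by \<open>out\<close>, so the
    spliced output is that of \<open>r\<close>.\<close>
  moreover have "(\<lambda>k. if k < cnt r 2 t then tape r' 2 k else tape r 2 k) = tape r 2"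
    using out cnt2 by (auto simp: word_prefix_eq_iff)
  ultimately have t2: "tape ?s 2 = tape r 2"
    using inf by (simp add: tape_eq_iff_spells)
  \<comment> \<open>The graft and \<open>r\<close> share oracle and output, so injectivity makes
    their inputs equal, although the graft begins with letters of \<open>x'\<close>.\<close>
  have "comp_out C (tape ?s 0) y (tape r 2)" "comp_out C x y (tape r 2)"
    using acc t1 t2 r by (auto simp: comp_out_def computes_def)
  then have "tape ?s 0 = x"
    using C unfolding compressor_def by blast
  then show ?thesis
    by (simp add: t0 fun_eq_iff word_prefix_eq_iff) metis
qed

subsection \<open>Stalling on the oracle\<close>

text \<open>Stopping is allowed in every state, which makes the predicate closed under prefixes of
  the oracle word.\<close>

inductive stalls :: "'a kaut \<Rightarrow> nat \<Rightarrow> 'a list \<Rightarrow> bool" for C where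
  Nil: "stalls C q []"
| eps: "(q, a, q') \<in> trans C \<Longrightarrow> a ! 0 = None \<Longrightarrow> a ! 1 = None \<Longrightarrow> stalls C q' v \<Longrightarrow> stalls C q v"
| read: "(q, a, q') \<in> trans C \<Longrightarrow> a ! 0 = None \<Longrightarrow> a ! 1 = Some b \<Longrightarrow> stalls C q' v \<Longrightarrow>
    stalls C q (b # v)"

lemma stalls_append: "stalls C q (v @ w) \<Longrightarrow> stalls C q v"
proof (induction q "v @ w" arbitrary: v rule: stalls.induct)
  case (read q a q' b u)
  then show ?case by (cases v) (auto intro: stalls.intros)
qed (auto intro: stalls.intros)

lemma run_stalls:
  assumes "is_run C r" "spells r 1 y" "t \<le> T" "\<And>i. t \<le> i \<Longrightarrow> i < T \<Longrightarrow> lab (r i) ! 0 = None"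
  shows "stalls C (fst (r t)) (map y [cnt r 1 t..<cnt r 1 T])"
  using assms(3,4)
proof (induction t rule: inc_induct)
  case base
  show ?case by (simp add: stalls.Nil)
next
  case (step t)
  have tr: "(fst (r t), lab (r t), fst (r (Suc t))) \<in> trans C"
    using assms(1) unfolding is_run_def lab_def by (metis prod.collapse)
  have IH: "stalls C (fst (r (Suc t))) (map y [cnt r 1 (Suc t)..<cnt r 1 T])"
    using step.IH step.prems by simp
  have 0: "lab (r t) ! 0 = None"
    using step by simp
  show ?case
  proof (cases "lab (r t) ! 1")
    case None
    then show ?thesis using stalls.eps[OF tr 0 _ IH] by (simp add: cnt_Suc)
  next
    case (Some b)
    then have "b = y (cnt r 1 t)" "cnt r 1 (Suc t) = Suc (cnt r 1 t)"
      using assms(2) by (auto simp: spells_def cnt_Suc)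
    moreover have "Suc (cnt r 1 t) \<le> cnt r 1 T"
      using calculation(2) step(2) cnt_mono[of "Suc t" T r 1] by simp
    ultimately show ?thesis
      using stalls.read[OF tr 0 Some IH] by (simp add: upt_conv_Cons)
  qed
qed

lemma l_detD:
  assumes "l_det k l M" "(p, a, q) \<in> trans M" "(p, a', q') \<in> trans M"
  shows "(\<forall>j<l. a ! j = None \<longrightarrow> a' ! j = None) \<and>
    ((\<forall>i<l. a ! i = a' ! i) \<longrightarrow> (\<forall>i. l \<le> i \<and> i < k \<longrightarrow> a ! i = a' ! i) \<and> q = q')"
  using assms unfolding l_det_def by blast

text \<open>The state alone decides which input tapes are read; the converse implications come from
  swapping the two transitions.\<close>

lemma l_det_2_step:
  assumes "l_det 3 2 C" "(p, a, q) \<in> trans C" "(p, a', q') \<in> trans C"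
  shows "a ! 0 = None \<longleftrightarrow> a' ! 0 = None" "a ! 1 = None \<longleftrightarrow> a' ! 1 = None"
    "a ! 0 = a' ! 0 \<Longrightarrow> a ! 1 = a' ! 1 \<Longrightarrow> q = q'"
proof -
  have *: "\<forall>j<2. a ! j = None \<longrightarrow> a' ! j = None" "\<forall>j<2. a' ! j = None \<longrightarrow> a ! j = None"
    using conjunct1[OF l_detD[OF assms]] conjunct1[OF l_detD[OF assms(1,3,2)]] .
  have **: "(\<forall>i<2. a ! i = a' ! i) \<longrightarrow> q = q'"
    using conjunct2[OF l_detD[OF assms]] by blast
  have lt2: "(\<forall>j<2. P j) \<longleftrightarrow> P 0 \<and> P 1" for P :: "nat \<Rightarrow> bool"
    by (auto simp: less_2_cases_iff)
  show "a ! 0 = None \<longleftrightarrow> a' ! 0 = None" "a ! 1 = None \<longleftrightarrow> a' ! 1 = None"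
    "a ! 0 = a' ! 0 \<Longrightarrow> a ! 1 = a' ! 1 \<Longrightarrow> q = q'"
    using * ** unfolding lt2 by auto
qed

text \<open>Converse of \<open>run_stalls\<close>: by determinism the actual run must follow the
  stalling path as long as the oracle agrees with \<open>v\<close>.\<close>

lemma stalls_run:
  assumes "stalls C (fst (r t)) v" "l_det 3 2 C" "is_run C r" "spells r 1 y"
    and "v = map y [cnt r 1 t..<m]" "t \<le> i" "cnt r 1 i < m"
  shows "lab (r i) ! 0 = None"
  using assms
proof (induction "fst (r t)" v arbitrary: t rule: stalls.induct)
  case Nil
  then show ?case using cnt_mono[of t i r 1] by simp
next
  case (eps a q' v)
  have tr: "(fst (r t), lab (r t), fst (r (Suc t))) \<in> trans C"
    using eps.prems unfolding is_run_def lab_def by (metis prod.collapse)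
  have lt: "lab (r t) ! 0 = None" "lab (r t) ! 1 = None"
    using l_det_2_step(1,2)[OF eps.prems(1) eps.hyps(1) tr] eps.hyps by auto
  then have "q' = fst (r (Suc t))"
    using l_det_2_step(3)[OF eps.prems(1) eps.hyps(1) tr] eps.hyps by simp
  then show ?case
    using eps.hyps(5)[of "Suc t"] eps.prems lt by (cases "t = i") (auto simp: cnt_Suc)
next
  case (read a q' b v)
  have tr: "(fst (r t), lab (r t), fst (r (Suc t))) \<in> trans C"
    using read.prems unfolding is_run_def lab_def by (metis prod.collapse)
  have lt: "lab (r t) ! 0 = None" "lab (r t) ! 1 \<noteq> None"
    using l_det_2_step(1,2)[OF read.prems(1) read.hyps(1) tr] read.hyps by auto
  have "cnt r 1 t < m"
    using read.prems(6,5) cnt_mono[of t i r 1] by simp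
  then have v: "b = y (cnt r 1 t)" "v = map y [Suc (cnt r 1 t)..<m]"
    using read.prems(4) by (auto simp: upt_conv_Cons)
  then have "lab (r t) ! 1 = Some b"
    using lt read.prems(3) by (auto simp: spells_def)
  then have "q' = fst (r (Suc t))"
    using l_det_2_step(3)[OF read.prems(1) read.hyps(1) tr] read.hyps lt by simp
  then show ?case
    using read.hyps(5)[of "Suc t"] read.prems lt v by (cases "t = i") (auto simp: cnt_Suc)
qed

text \<open>A word s minimising the number of states that can stall through it is escape-proof:
  a state that stalls through s also stalls through every extension of s.\<close>

lemma ex_trap_word:
  assumes "finite (states C)"
  shows "\<exists>s. \<forall>q\<in>states C. stalls C q s \<longrightarrow> (\<forall>v. stalls C q (s @ v))"
proof -
  define D where "D v = {q \<in> states C. stalls C q v}" for v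
  obtain s where s: "card (D s) \<le> card (D v)" for v
    using ex_has_least_nat[of "\<lambda>_. True" _ "\<lambda>v. card (D v)"] by auto
  \<comment> \<open>Prefix closure gives one inclusion; minimality of \<open>card (D s)\<close>
    makes it an equality.\<close>
  have "D (s @ v) = D s" for v
  proof (rule card_seteq)
    show "finite (D s)" "D (s @ v) \<subseteq> D s" "card (D s) \<le> card (D (s @ v))"
      using assms s by (auto simp: D_def dest: stalls_append)
  qed
  then show ?thesis
    unfolding D_def by blast
qed

section \<open>Bounding the oracle position by occurrences of a word\<close>

definition occurs :: "'a list \<Rightarrow> (nat \<Rightarrow> 'a) \<Rightarrow> nat \<Rightarrow> bool" where
  "occurs s y m \<longleftrightarrow> map y [m..<m + length s] = s"

text \<open>Only occurrences aligned in blocks of length \<open>length s\<close> count, so that they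
  are independent events. The range of \<open>m\<close> is the bound of \<open>cnt1_bound\<close>
  for \<open>n\<close> input letters.\<close>

definition dense :: "'a list \<Rightarrow> (nat \<Rightarrow> 'a) \<Rightarrow> nat \<Rightarrow> bool" where
  "dense s y n \<longleftrightarrow>
     (\<forall>m \<le> Suc n * Suc (n * length s). \<exists>i<n. occurs s y (m + i * length s))"

text \<open>Induction on the number of input letters read. A stall over more than
  \<open>n * length s\<close> oracle cells would read a copy of \<open>s\<close>; the trap would
  then prevent any further input letter, but an accepting run reads infinitely many.\<close>

lemma cnt1_bound:
  assumes C: "l_det 3 2 C" and trap: "\<forall>q\<in>states C. stalls C q s \<longrightarrow> (\<forall>v. stalls C q (s @ v))"
    and r: "computes C r x y" and y: "dense s y n"
  shows "cnt r 0 T \<le> n \<Longrightarrow> cnt r 1 T \<le> Suc (cnt r 0 T) * Suc (n * length s)"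
proof (induction "cnt r 0 T" arbitrary: T rule: less_induct)
  case less
  have run: "is_run C r" and st: "fst (r i) \<in> states C" for i
  proof -
    show run: "is_run C r"
      using r by (simp add: computes_def accepting_def)
    have "(fst (r i), lab (r i), fst (r (Suc i))) \<in> trans C"
      using run unfolding is_run_def lab_def by (metis prod.collapse)
    then show "fst (r i) \<in> states C"
      using C unfolding l_det_def is_kaut_def by blast
  qed
  \<comment> \<open>The time right after the last input letter before \<open>T\<close>, or 0; from
    \<open>t\<close> to \<open>T\<close> the run stalls.\<close>
  define t where "t = (LEAST t. cnt r 0 t = cnt r 0 T)"
  have t: "cnt r 0 t = cnt r 0 T" "t \<le> T"
    unfolding t_def by (rule LeastI, rule refl) (rule Least_le, rule refl)
  \<comment> \<open>The extra 1 is for an oracle letter consumed by the very transition that reads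
    this input letter.\<close>
  have t_le: "cnt r 1 t \<le> cnt r 0 T * Suc (n * length s) + 1"
  proof (cases t)
    case (Suc u)
    then have "cnt r 0 u \<noteq> cnt r 0 T"
      using not_less_Least[of u "\<lambda>t. cnt r 0 t = cnt r 0 T"] by (simp add: t_def)
    then have u: "cnt r 0 T = Suc (cnt r 0 u)"
      using t Suc by (simp add: cnt_Suc split: if_splits)
    then have "cnt r 1 u \<le> Suc (cnt r 0 u) * Suc (n * length s)"
      using less by simp
    then show ?thesis
      using Suc u by (simp add: cnt_Suc)
  qed simp
  have stall: "lab (r i) ! 0 = None" if "t \<le> i" "i < T" for i
    using that t cnt_mono[of t i r 0] cnt_mono[of "Suc i" T r 0] by (auto simp: cnt_Suc split: if_splits)
  have "cnt r 1 T \<le> cnt r 1 t + n * length s"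
  proof (rule ccontr)
    assume "\<not> ?thesis"
    then have big: "cnt r 1 t + n * length s < cnt r 1 T" by simp
    \<comment> \<open>At most \<open>n\<close> input letters were read, so the stall starts in the
      range covered by \<open>dense\<close>.\<close>
    have "cnt r 0 T * Suc (n * length s) + 1 \<le> Suc n * Suc (n * length s)"
      using mult_le_mono1[OF less.prems, of "Suc (n * length s)"] by simp
    then obtain i where i: "i < n" "occurs s y (cnt r 1 t + i * length s)"
      using y t_le unfolding dense_def by (meson le_trans)
    define m where "m = cnt r 1 t + i * length s"
    have "Suc i * length s \<le> n * length s"
      using i by (intro mult_le_mono1) simp
    then have m: "cnt r 1 t \<le> m" "m + length s < cnt r 1 T"
      using big by (auto simp: m_def)
    then obtain t' where t': "t \<le> t'" "t' \<le> T" "cnt r 1 t' = m"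
      using cnt_attained[of t T r 1 m] t(2) by auto
    have "stalls C (fst (r t')) (map y [m..<cnt r 1 T])"
      using run_stalls[OF run computes_spells(2)[OF r] t'(2)] stall t' by simp
    moreover have "[m..<cnt r 1 T] = [m..<m + length s] @ [m + length s..<cnt r 1 T]"
      using m upt_add_eq_append[of m "m + length s" "cnt r 1 T - (m + length s)"] by simp
    ultimately have "stalls C (fst (r t')) s"
      using i(2) by (auto simp: occurs_def m_def intro: stalls_append)
    then have tr: "stalls C (fst (r t')) (s @ v)" for v
      using trap st by blast
    \<comment> \<open>The trap lets \<open>s\<close> be prolonged by the actual oracle letters; the
      length is chosen so that the word ends beyond the oracle position at time
      \<open>i\<close>.\<close>
    have none: "lab (r i) ! 0 = None" if "t' \<le> i" for i
    proof (rule stalls_run[OF tr[of "map y [m + length s..<m + length s + Suc (cnt r 1 i)]"] C run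
          computes_spells(2)[OF r]])
      show "s @ map y [m + length s..<m + length s + Suc (cnt r 1 i)] =
          map y [cnt r 1 t'..<m + length s + Suc (cnt r 1 i)]"
        using i(2) upt_add_eq_append[of m "m + length s" "Suc (cnt r 1 i)"]
        by (simp only: occurs_def map_append t'(3) m_def[symmetric])
    qed (use that in auto)
    have "tape_pos r 0 \<subseteq> {..<t'}"
    proof
      fix i assume "i \<in> tape_pos r 0"
      then have "\<not> t' \<le> i"
        using none by (auto simp: tape_pos_def)
      then show "i \<in> {..<t'}"
        by simp
    qed
    then show False
      using computes_infinite[OF r, of 0] finite_subset by auto
  qed
  then show ?case
    using t_le by simp
qed

subsection \<open>The uniform measure\<close>

lemma sequence_space_unif: "sequence_space (measure_pmf (pmf_of_set (UNIV :: 'a::finite set)))"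
  by (simp add: sequence_space_def product_prob_space_def product_prob_space_axioms_def
      product_sigma_finite_def prob_space.axioms(1) prob_space_measure_pmf prob_space_imp_sigma_finite)

lemma space_unif_words [simp]: "space (unif_words :: (nat \<Rightarrow> 'a::finite) measure) = UNIV"
  by (simp add: unif_words_def space_PiM PiE_UNIV_domain)

lemma prob_space_unif_words: "prob_space (unif_words :: (nat \<Rightarrow> 'a::finite) measure)"
  unfolding unif_words_def by (intro prob_space_PiM prob_space_measure_pmf)

interpretation unif_words: prob_space "unif_words :: (nat \<Rightarrow> 'a::finite) measure"
  by (rule prob_space_unif_words)

lemma measurable_letter [measurable]:
  "(\<lambda>x. x i) \<in> unif_words \<rightarrow>\<^sub>M count_space (UNIV :: 'a::finite set)"
proof -
  have "(\<lambda>x. x i) \<in> unif_words \<rightarrow>\<^sub>M measure_pmf (pmf_of_set (UNIV :: 'a set))"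
    unfolding unif_words_def by (rule measurable_component_singleton) simp
  then show ?thesis
    by (simp cong: measurable_cong_sets)
qed

lemma word_prefix_eq_list_iff: "word_prefix x (length u) = u \<longleftrightarrow> (\<forall>i<length u. x i = u ! i)"
  unfolding word_prefix_def list_eq_iff_nth_eq by simp

lemma occurs_iff: "occurs s y m \<longleftrightarrow> (\<forall>i<length s. y (m + i) = s ! i)"
  unfolding occurs_def list_eq_iff_nth_eq by simp

lemma measure_cylinder:
  fixes u :: "'a::finite list"
  shows "measure unif_words {x. word_prefix x (length u) = u} = (1 / CARD('a)) ^ length u"
proof -
  interpret sequence_space "measure_pmf (pmf_of_set (UNIV :: 'a set))"
    by (rule sequence_space_unif)
  have "{x. word_prefix x (length u) = u} =
      {x \<in> space (PiM UNIV (\<lambda>_. measure_pmf (pmf_of_set UNIV))). \<forall>i\<in>{..<length u}. x i \<in> {u ! i}}"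
    by (simp add: space_PiM word_prefix_eq_list_iff PiE_UNIV_domain Ball_def)
  then have "emeasure unif_words {x. word_prefix x (length u) = u} =
      (\<Prod>i<length u. emeasure (measure_pmf (pmf_of_set (UNIV :: 'a set))) {u ! i})"
    unfolding unif_words_def by (simp only:) (rule emeasure_PiM_Collect; simp)
  also have "\<dots> = ennreal ((1 / CARD('a)) ^ length u)"
    by (simp add: emeasure_pmf_single pmf_of_set flip: ennreal_power)
  finally show ?thesis
    by (simp add: measure_def)
qed

lemma measurable_word_prefix [measurable]:
  "(\<lambda>x. word_prefix x n) \<in> unif_words \<rightarrow>\<^sub>M count_space (UNIV :: 'a::finite list set)"
proof (induction n)
  case (Suc n)
  have "(\<lambda>x. word_prefix x n @ [x n]) \<in> unif_words \<rightarrow>\<^sub>M count_space (UNIV :: 'a list set)"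
    by (rule measurable_compose_countable[OF _ Suc, of "\<lambda>u x. u @ [x n]"]) measurable
  then show ?case
    by (simp add: word_prefix_def)
qed (simp add: word_prefix_def)

lemma measure_word_prefix_le:
  fixes V :: "'a::finite list set"
  assumes "finite V" "\<And>u. u \<in> V \<Longrightarrow> length u = n"
  shows "measure unif_words {x. word_prefix x n \<in> V} \<le> card V * (1 / CARD('a)) ^ n"
proof -
  have sets: "{x. word_prefix x n = u} \<in> sets unif_words" for u :: "'a list"
  proof -
    have "{x \<in> space unif_words. word_prefix x n = u} \<in> sets unif_words" by measurable
    then show ?thesis by simp
  qed
  have "{x. word_prefix x n \<in> V} = (\<Union>u\<in>V. {x. word_prefix x n = u})" by auto
  then have "measure unif_words {x. word_prefix x n \<in> V} \<le> (\<Sum>u\<in>V. measure unif_words {x. word_prefix x n = u})"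
    using assms sets by (auto intro!: unif_words.finite_measure_subadditive_finite)
  also have "\<dots> = (\<Sum>u\<in>V. (1 / CARD('a)) ^ n)"
    using assms(2) measure_cylinder by (intro sum.cong) auto
  finally show ?thesis by simp
qed

text \<open>\<open>comb_seq m\<close> puts the first \<open>m\<close> letters of \<open>x\<close> in
  front of \<open>y\<close> and preserves the product measure; events separated by position
  \<open>m\<close> are therefore independent.\<close>

lemma measure_comb_seq:
  fixes A B :: "(nat \<Rightarrow> 'a::finite) set"
  assumes [measurable]: "A \<in> sets unif_words" "B \<in> sets unif_words" "E \<in> sets unif_words"
    and E: "\<And>x y. comb_seq m x y \<in> E \<longleftrightarrow> x \<in> A \<and> y \<in> B"
  shows "measure unif_words E = measure unif_words A * measure unif_words B"
proof -
  interpret sequence_space "measure_pmf (pmf_of_set (UNIV :: 'a set))"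
    by (rule sequence_space_unif)
  have "emeasure unif_words E = emeasure (distr (unif_words \<Otimes>\<^sub>M unif_words) unif_words
      (\<lambda>(x, y). comb_seq m x y)) E"
    using PiM_comb_seq[of m] by (simp add: unif_words_def)
  also have "\<dots> = emeasure (unif_words \<Otimes>\<^sub>M unif_words) (A \<times> B)"
    using E measurable_comb_seq[of m "measure_pmf (pmf_of_set (UNIV :: 'a set))"]
    by (subst emeasure_distr) (auto simp: unif_words_def[symmetric] space_pair_measure
        intro!: arg_cong[where f = "emeasure _"])
  also have "\<dots> = emeasure unif_words A * emeasure unif_words B"
    by (intro unif_words.emeasure_pair_measure_Times assms)
  finally show ?thesis
    by (simp add: measure_def enn2real_mult)
qed

lemma occurs_comb_seq:
  "occurs s (comb_seq k x y) (k + m) \<longleftrightarrow> occurs s y m"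
  "m + length s \<le> k \<Longrightarrow> occurs s (comb_seq k x y) m \<longleftrightarrow> occurs s x m"
  by (simp_all add: occurs_iff comb_seq_def add.assoc)

lemma measurable_occurs [measurable]:
  "Measurable.pred unif_words (\<lambda>y. occurs (s :: 'a::finite list) y m)"
  unfolding occurs_iff by simp

text \<open>The blocks are disjoint, so the \<open>n\<close> failures are independent and equally
  likely.\<close>

lemma measure_not_occurs:
  fixes s :: "'a::finite list"
  shows "measure unif_words {y. \<forall>i<n. \<not> occurs s y (m + i * length s)} =
    (1 - (1 / CARD('a)) ^ length s) ^ n"
proof -
  define N where "N m n = {y. \<forall>i<n. \<not> occurs s y (m + i * length s)}" for m n
  have [measurable]: "N m n \<in> sets unif_words" for m n
  proof -
    have "{y \<in> space unif_words. \<forall>i<n. \<not> occurs s y (m + i * length s)} \<in> sets unif_words"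
      by measurable
    then show ?thesis by (simp add: N_def)
  qed
  have [measurable]: "UNIV \<in> sets (unif_words :: (nat \<Rightarrow> 'a) measure)"
    using sets.top[of "unif_words :: (nat \<Rightarrow> 'a) measure"] by simp
  have UNIV: "measure unif_words (UNIV :: (nat \<Rightarrow> 'a) set) = 1"
    using unif_words.prob_space by simp
  \<comment> \<open>Shift invariance: the first \<open>m\<close> letters are unconstrained, hence
    the factor for \<open>UNIV\<close>.\<close>
  have shift: "measure unif_words (N m n) = measure unif_words (N 0 n)" for m n
  proof -
    have "measure unif_words (N m n) = measure unif_words (UNIV :: (nat \<Rightarrow> 'a) set) * measure unif_words (N 0 n)"
      by (rule measure_comb_seq[of _ _ _ m]) (measurable, auto simp: N_def occurs_comb_seq)
    then show ?thesis by (simp add: UNIV)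
  qed
  have "measure unif_words (N 0 1) = 1 - measure unif_words {y. word_prefix y (length s) = s}"
  proof -
    have "{y. occurs s y 0} \<in> sets unif_words"
      using measurable_occurs[of s 0] by (simp add: pred_def)
    moreover have "N 0 1 = space unif_words - {y. occurs s y 0}"
      by (auto simp: N_def)
    ultimately have "measure unif_words (N 0 1) = 1 - measure unif_words {y. occurs s y 0}"
      by (simp only: unif_words.prob_compl)
    then show ?thesis
      by (simp add: occurs_iff word_prefix_eq_list_iff)
  qed
  then have N1: "measure unif_words (N 0 1) = 1 - (1 / CARD('a)) ^ length s"
    by (simp add: measure_cylinder)
  have "measure unif_words (N 0 n) = (1 - (1 / CARD('a)) ^ length s) ^ n"
  proof (induction n)
    case 0
    then show ?case using UNIV by (simp add: N_def)
  next
    case (Suc n)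
    \<comment> \<open>Cutting after the first block separates it from the remaining ones.\<close>
    have "measure unif_words (N 0 (Suc n)) = measure unif_words (N 0 1) * measure unif_words (N 0 n)"
    proof (rule measure_comb_seq[of _ _ _ "length s"])
      show "comb_seq (length s) x y \<in> N 0 (Suc n) \<longleftrightarrow> x \<in> N 0 1 \<and> y \<in> N 0 n" for x y
        by (auto simp: N_def occurs_comb_seq All_less_Suc2)
    qed measurable
    then show ?case by (simp only: Suc N1 power_Suc)
  qed
  then show ?thesis
    using shift by (simp add: N_def)
qed

section \<open>Borel-Cantelli for the oracle\<close>

lemma summable_poly_times_geometric:
  fixes c :: real
  assumes "0 \<le> c" "c < 1"
  shows "summable (\<lambda>n. real (Suc n) ^ k * c ^ n)"
proof (cases "c = 0")
  case False
  \<comment> \<open>Any ratio strictly between \<open>c\<close> and 1 absorbs the polynomial; for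
    \<open>c = 0\<close> all terms but the first vanish.\<close>
  define d where "d = (1 + c) / 2"
  have d: "c < d" "0 < d" "d < 1"
    using assms by (auto simp: d_def)
  have "(\<lambda>n. real (Suc n) ^ k * c ^ n) \<in> O(\<lambda>n. d ^ n)"
    using d False assms by real_asymp
  moreover have "summable (\<lambda>n. norm (d ^ n))"
    using d by (simp add: summable_geometric norm_power)
  ultimately show ?thesis
    by (rule summable_comparison_test_bigo[rotated])
qed (auto intro: summable_finite[of "{0}"])

lemma measurable_dense [measurable]: "Measurable.pred unif_words (\<lambda>y. dense (s :: 'a::finite list) y n)"
  unfolding dense_def by measurable

text \<open>Union bound over polynomially many window starts, each failing with probability
  exponentially small in \<open>n\<close>; then Borel-Cantelli.\<close>

lemma AE_dense:
  fixes s :: "'a::finite list"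
  shows "AE y in unif_words. \<forall>\<^sub>F n in sequentially. dense s y n"
proof -
  define c where "c = 1 - (1 / CARD('a)) ^ length s"
  have c: "0 \<le> c" "c < 1"
    by (auto simp: c_def power_le_one)
  define K where "K n = Suc n * Suc (n * length s)" for n
  have K: "real (Suc (K n)) \<le> (length s + 2) * real (Suc n) ^ 2" for n
    by (simp add: K_def algebra_simps power2_eq_square)
  have meas: "{y. \<not> dense s y n} \<in> sets unif_words" for n
  proof -
    have "{y \<in> space unif_words. \<not> dense s y n} \<in> sets unif_words" by measurable
    then show ?thesis by simp
  qed
  have le: "measure unif_words {y. \<not> dense s y n} \<le> (length s + 2) * (real (Suc n) ^ 2 * c ^ n)" for n
  proof -
    let ?N = "\<lambda>m. {y. \<forall>i<n. \<not> occurs s y (m + i * length s)}"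
    have "?N m \<in> sets unif_words" for m
    proof -
      have "{y \<in> space unif_words. \<forall>i<n. \<not> occurs s y (m + i * length s)} \<in> sets unif_words"
        by measurable
      then show ?thesis by simp
    qed
    moreover have "{y. \<not> dense s y n} = (\<Union>m\<le>K n. ?N m)"
      by (auto simp: dense_def K_def)
    ultimately have "measure unif_words {y. \<not> dense s y n} \<le> (\<Sum>m\<le>K n. measure unif_words (?N m))"
      by (auto intro!: unif_words.finite_measure_subadditive_finite)
    also have "\<dots> = real (Suc (K n)) * c ^ n"
      by (simp add: measure_not_occurs c_def)
    also have "\<dots> \<le> (length s + 2) * real (Suc n) ^ 2 * c ^ n"
      using K[of n] c by (intro mult_right_mono) auto
    finally show ?thesis by (simp add: mult.assoc)
  qed
  have "summable (\<lambda>n. measure unif_words {y. \<not> dense s y n})"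
  proof (rule summable_comparison_test')
    show "summable (\<lambda>n. (length s + 2) * (real (Suc n) ^ 2 * c ^ n))"
      by (intro summable_mult summable_poly_times_geometric c)
  qed (use le in simp)
  then have "AE y in unif_words. \<forall>\<^sub>F n in sequentially. y \<in> space unif_words - {y. \<not> dense s y n}"
    using meas by (intro borel_cantelli_AE1) (auto simp: less_top[symmetric])
  then show ?thesis by simp
qed

subsection \<open>Badly compressed prefixes\<close>

definition bad_prefixes :: "'a kaut \<Rightarrow> (nat \<Rightarrow> 'a) \<Rightarrow> nat \<Rightarrow> real \<Rightarrow> nat \<Rightarrow> 'a list set" where
  "bad_prefixes C y b c n = {word_prefix x n | x r T. computes C r x y \<and> cnt r 0 T = n \<and>
     cnt r 1 T \<le> b \<and> real (cnt r 2 T) \<le> c * n}"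

text \<open>Pigeonhole: by \<open>compressor_prefix_eq\<close> the state, the oracle position and
  the output so far determine the prefix, so it suffices to count such triples.\<close>

lemma card_bad_prefixes:
  fixes C :: "'a::finite kaut"
  assumes C: "compressor C" and A: "CARD('a) \<ge> 2" and c: "0 \<le> c" "c \<le> 1"
  shows "real (card (bad_prefixes C y b c n)) \<le>
    card (states C) * Suc b * (Suc n * CARD('a) powr (c * n))"
proof -
  define L where "L = nat \<lfloor>c * n\<rfloor>"
  have L: "real L \<le> c * n"
    using c by (simp add: L_def)
  have "c * n \<le> n"
    using c by (simp add: mult_left_le_one_le)
  then have L_le: "L \<le> n"
    using L by linarith
  define W where "W = {w :: 'a list. set w \<subseteq> UNIV \<and> length w \<le> L}"
  have cardW: "card W = (\<Sum>i\<le>L. CARD('a) ^ i)"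
    unfolding W_def by (rule card_lists_length_le) simp
  have finW: "finite W"
    unfolding W_def by (rule finite_lists_length_le) simp
  \<comment> \<open>For each bad prefix a witnessing run and time are chosen; different prefixes may
    use unrelated runs.\<close>
  define Q where "Q u = (\<lambda>(x, r, T). u = word_prefix x n \<and> computes C r x y \<and>
      cnt r 0 T = n \<and> cnt r 1 T \<le> b \<and> real (cnt r 2 T) \<le> c * n)" for u
  have "\<forall>u\<in>bad_prefixes C y b c n. \<exists>p. Q u p"
    by (fastforce simp: bad_prefixes_def Q_def)
  then obtain p where p: "\<And>u. u \<in> bad_prefixes C y b c n \<Longrightarrow> Q u (p u)"
    by metis
  define key where "key = (\<lambda>(x :: nat \<Rightarrow> 'a, r :: 'a run, T).
      (fst (r T), cnt r 1 T, word_prefix (tape r 2) (cnt r 2 T)))"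
  have st: "fst (r T) \<in> states C" if "computes C r x y" for r x T
  proof -
    have "(fst (r T), lab (r T), fst (r (Suc T))) \<in> trans C"
      using that unfolding computes_def accepting_def is_run_def lab_def by (metis prod.collapse)
    then show ?thesis
      using C unfolding compressor_def l_det_def is_kaut_def by blast
  qed
  have fin: "finite (states C)"
    using C by (simp add: compressor_def l_det_def is_kaut_def)
  have "inj_on (\<lambda>u. key (p u)) (bad_prefixes C y b c n)"
  proof (rule inj_onI)
    fix u u' assume u: "u \<in> bad_prefixes C y b c n" "u' \<in> bad_prefixes C y b c n" "key (p u) = key (p u')"
    obtain x r T x' r' T' where eq: "p u = (x, r, T)" "p u' = (x', r', T')"
      by (metis prod_cases3)
    have "key (x, r, T) = key (x', r', T')"
      using u(3) by (simp only: eq)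
    moreover have "Q u (x, r, T)" "Q u' (x', r', T')"
      using p[OF u(1)] p[OF u(2)] by (simp_all only: eq)
    ultimately show "u = u'"
      using compressor_prefix_eq[OF C, of r x y r' x' T' T] by (simp add: key_def Q_def)
  qed
  moreover have "(\<lambda>u. key (p u)) ` bad_prefixes C y b c n \<subseteq> states C \<times> {..b} \<times> W"
  proof (rule image_subsetI)
    fix u assume u: "u \<in> bad_prefixes C y b c n"
    obtain x r T where eq: "p u = (x, r, T)"
      by (metis prod_cases3)
    have "Q u (x, r, T)"
      using p[OF u] by (simp only: eq)
    then show "key (p u) \<in> states C \<times> {..b} \<times> W"
      unfolding eq using st by (auto simp: key_def Q_def W_def L_def le_nat_floor)
  qed
  ultimately have "card (bad_prefixes C y b c n) \<le> card (states C \<times> {..b} \<times> W)"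
    using fin finW by (intro card_inj_on_le) auto
  then have 1: "real (card (bad_prefixes C y b c n)) \<le> card (states C) * Suc b * real (card W)"
    unfolding of_nat_mult[symmetric] of_nat_le_iff
    by (simp only: card_cartesian_product card_atMost mult.assoc)
  have "real (card W) = (\<Sum>i\<le>L. real CARD('a) ^ i)"
    by (simp add: cardW)
  also have "\<dots> \<le> (\<Sum>i\<le>L. real CARD('a) ^ L)"
    using A by (intro sum_mono power_increasing) auto
  also have "\<dots> = Suc L * real CARD('a) powr L"
    using A by (simp add: powr_realpow)
  also have "\<dots> \<le> Suc n * real CARD('a) powr (c * n)"
    using A L L_le by (intro mult_mono powr_mono) auto
  finally have 2: "real (card W) \<le> Suc n * real CARD('a) powr (c * n)" .
  show ?thesis
    by (intro order_trans[OF 1] mult_left_mono 2) simp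
qed

lemma finite_bad_prefixes: "finite (bad_prefixes (C :: 'a::finite kaut) y b c n)"
  by (rule finite_subset[OF _ finite_lists_length_eq[of UNIV n]]) (auto simp: bad_prefixes_def)

text \<open>There are at most polynomially many times \<open>CARD('a) powr (c * n)\<close> bad
  prefixes, each of measure \<open>(1 / CARD('a)) ^ n\<close>, so Borel-Cantelli applies.\<close>

lemma AE_not_bad:
  fixes C :: "'a::finite kaut"
  assumes C: "compressor C" and A: "CARD('a) \<ge> 2" and c: "0 \<le> c" "c < 1"
  shows "AE x in unif_words. \<forall>\<^sub>F n in sequentially.
    word_prefix x n \<notin> bad_prefixes C y (Suc n * Suc (n * l)) c n"
proof -
  define V where "V n = bad_prefixes C y (Suc n * Suc (n * l)) c n" for n
  \<comment> \<open>The decay rate per letter, below 1 because \<open>c < 1\<close> and there are at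
    least two letters.\<close>
  define d where "d = real CARD('a) powr (c - 1)"
  have d: "0 \<le> d" "d < 1"
    using A c by (auto simp: d_def powr_less_one)
  have meas: "{x. word_prefix x n \<in> V n} \<in> sets unif_words" for n
  proof -
    have "{x \<in> space unif_words. word_prefix x n \<in> V n} \<in> sets unif_words" by measurable
    then show ?thesis by simp
  qed
  let ?K = "real (card (states C)) * (l + 2)"
  have le: "measure unif_words {x. word_prefix x n \<in> V n} \<le> ?K * (real (Suc n) ^ 3 * d ^ n)" for n
  proof -
    have "measure unif_words {x. word_prefix x n \<in> V n} \<le> card (V n) * (1 / CARD('a)) ^ n"
      by (rule measure_word_prefix_le) (auto simp: V_def finite_bad_prefixes, auto simp: bad_prefixes_def)
    also have "\<dots> \<le> card (states C) * Suc (Suc n * Suc (n * l)) *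
        (Suc n * CARD('a) powr (c * n)) * (1 / CARD('a)) ^ n"
      unfolding V_def using c by (intro mult_right_mono card_bad_prefixes C A) auto
    also have "\<dots> = card (states C) * real (Suc (Suc n * Suc (n * l))) * (real (Suc n) * d ^ n)"
    proof -
      have "d ^ n = CARD('a) powr ((c - 1) * n)"
        using A by (simp add: d_def powr_powr flip: powr_realpow)
      also have "\<dots> = CARD('a) powr (c * n) * (1 / CARD('a)) ^ n"
        using A by (simp add: left_diff_distrib powr_diff powr_realpow power_one_over field_simps)
      finally show ?thesis
        by (simp only: of_nat_mult mult.assoc)
    qed
    \<comment> \<open>A quadratic factor from the oracle positions and a linear one from the output
      lengths give the cube.\<close>
    also have "\<dots> \<le> card (states C) * ((l + 2) * real (Suc n) ^ 2) * (real (Suc n) * d ^ n)"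
    proof -
      have "real (Suc (Suc n * Suc (n * l))) \<le> (l + 2) * real (Suc n) ^ 2"
        by (simp add: algebra_simps power2_eq_square)
      then show ?thesis
        using d by (intro mult_right_mono mult_left_mono) auto
    qed
    finally show ?thesis
      by (simp only: power2_eq_square power3_eq_cube mult_ac)
  qed
  have "summable (\<lambda>n. measure unif_words {x. word_prefix x n \<in> V n})"
  proof (rule summable_comparison_test')
    show "summable (\<lambda>n. ?K * (real (Suc n) ^ 3 * d ^ n))"
      by (intro summable_mult summable_poly_times_geometric d)
  qed (use le in simp)
  then have "AE x in unif_words. \<forall>\<^sub>F n in sequentially. x \<in> space unif_words - {x. word_prefix x n \<in> V n}"
    using meas by (intro borel_cantelli_AE1) (auto simp: less_top[symmetric])
  then show ?thesis by (simp add: V_def)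
qed

section \<open>From prefixes to the compression ratio\<close>

lemma cnt_at_top:
  assumes "infinite (tape_pos r j)"
  shows "filterlim (cnt r j) at_top sequentially"
  unfolding filterlim_at_top
proof
  fix m
  obtain t where "m \<le> cnt r j t"
    using cnt_unbounded[OF assms] by blast
  then show "\<forall>\<^sub>F n in sequentially. m \<le> cnt r j n"
    unfolding eventually_sequentially using cnt_mono[of t _ r j] by (meson le_trans)
qed

text \<open>\<open>cnt1_bound\<close> keeps the oracle position in the range allowed by
  \<open>bad_prefixes\<close>, so a prefix that is not bad can only have failed the output
  bound.\<close>

lemma comp_ratio_ge:
  assumes r: "computes C r x y" and c: "0 \<le> c"
    and dense: "\<forall>\<^sub>F n in sequentially. dense s y n"
    and trap: "\<forall>q\<in>states C. stalls C q s \<longrightarrow> (\<forall>v. stalls C q (s @ v))"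
    and C: "l_det 3 2 C"
    and good: "\<forall>\<^sub>F n in sequentially. word_prefix x n \<notin> bad_prefixes C y (Suc n * Suc (n * length s)) c n"
  shows "ereal c \<le> comp_ratio r"
proof -
  have "\<forall>\<^sub>F n in sequentially. \<forall>T. cnt r 0 T = n \<longrightarrow> c * n \<le> cnt r 2 T"
    using dense good
  proof eventually_elim
    case (elim n)
    show ?case
    proof (intro allI impI)
      fix T assume T: "cnt r 0 T = n"
      then have "cnt r 1 T \<le> Suc n * Suc (n * length s)"
        using cnt1_bound[OF C trap r elim(1), of T] by simp
      then show "c * n \<le> cnt r 2 T"
        using elim(2) r T unfolding bad_prefixes_def by force
    qed
  qed
  \<comment> \<open>Transfers a statement about all large prefix lengths to all large times.\<close>
  moreover have top: "filterlim (cnt r 0) at_top sequentially"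
    using computes_infinite[OF r] by (intro cnt_at_top) simp
  ultimately have "\<forall>\<^sub>F T in sequentially. c * cnt r 0 T \<le> cnt r 2 T"
    by (drule_tac eventually_compose_filterlim) (auto elim!: eventually_mono)
  \<comment> \<open>Excludes the initial quotients with denominator 0, whose value is 0.\<close>
  moreover have "\<forall>\<^sub>F T in sequentially. 1 \<le> cnt r 0 T"
    using top unfolding filterlim_at_top by blast
  ultimately have "\<forall>\<^sub>F T in sequentially. ereal c \<le> ereal (real (cnt r 2 T) / real (cnt r 0 T))"
    by eventually_elim (simp add: field_simps)
  then show ?thesis
    unfolding comp_ratio_def cnt_def[symmetric] by (rule Liminf_bounded)
qed

text \<open>The oracle is fixed first: the trap word depends only on \<open>C\<close>, and the null
  set of inputs may then depend on \<open>y\<close>.\<close>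

lemma AE_compressor_ratio_ge_1:
  fixes C :: "'a::finite kaut"
  assumes C: "compressor C" and A: "CARD('a) \<ge> 2"
  shows "AE y in unif_words. AE x in unif_words. \<forall>r. computes C r x y \<longrightarrow> 1 \<le> comp_ratio r"
proof -
  have det: "l_det 3 2 C"
    using C by (simp add: compressor_def)
  then have fin: "finite (states C)"
    by (simp add: l_det_def is_kaut_def)
  obtain s where trap: "\<forall>q\<in>states C. stalls C q s \<longrightarrow> (\<forall>v. stalls C q (s @ v))"
    using ex_trap_word[OF fin] by blast
  \<comment> \<open>Countably many bounds tending to 1, so that the exceptional set stays
    null.\<close>
  define c where "c k = 1 - 1 / real (Suc k)" for k
  have c: "0 \<le> c k" "c k < 1" for k
    by (auto simp: c_def)
  show ?thesis
    using AE_dense[of s]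
  proof eventually_elim
    case (elim y)
    have "AE x in unif_words. \<forall>k. \<forall>\<^sub>F n in sequentially.
        word_prefix x n \<notin> bad_prefixes C y (Suc n * Suc (n * length s)) (c k) n"
      unfolding AE_all_countable by (intro allI AE_not_bad C A c)
    then show ?case
    proof eventually_elim
      case good: (elim x)
      show ?case
      proof (intro allI impI)
        fix r assume r: "computes C r x y"
        have le: "ereal (c k) \<le> comp_ratio r" for k
          using good by (intro comp_ratio_ge[OF r c(1) elim trap det]) auto
        have lim: "(\<lambda>k. ereal (c k)) \<longlonglongrightarrow> ereal 1"
          unfolding c_def lim_ereal by real_asymp
        have "ereal 1 \<le> comp_ratio r"
          by (intro tendsto_upperbound[OF lim] always_eventually allI le trivial_limit_sequentially)
        then show "1 \<le> comp_ratio r"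
          by (simp add: one_ereal_def)
      qed
    qed
  qed
qed

subsection \<open>Measurability\<close>

definition ratio :: "'a run \<Rightarrow> nat \<Rightarrow> ereal" where
  "ratio r j = liminf (\<lambda>n. ereal (real (cnt r j n) / real (cnt r 0 n)))"

lemma comp_ratio_eq: "comp_ratio r = ratio r 2"
  by (simp add: comp_ratio_def ratio_def cnt_def)

text \<open>Between two input letters the quotient of output to input only grows, so it suffices to
  look at the times right after an input letter.\<close>

lemma trans_ratio_eq:
  assumes inf: "infinite (tape_pos r 0)"
  shows "trans_ratio r = ratio r 1"
proof -
  \<comment> \<open>The time right after input letter number \<open>m\<close>, counted from
    0.\<close>
  define e where "e m = Suc (enumerate (tape_pos r 0) m)" for m
  have "{i. i \<le> enumerate (tape_pos r 0) m \<and> lab (r i) ! 1 \<noteq> None} =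
      {i. i < e m \<and> lab (r i) ! 1 \<noteq> None}" for m
    by (auto simp: e_def)
  then have T: "trans_ratio r = liminf (\<lambda>m. ereal (real (cnt r 1 (e m)) / real (Suc m)))"
    by (simp add: trans_ratio_def cnt_def)
  have cnt0: "cnt r 0 (e m) = Suc m" for m
    using enumerate_in_set[OF inf, of m] cnt_enumerate[OF inf, of m]
    by (auto simp: e_def cnt_Suc tape_pos_def)
  have mono: "strict_mono e"
    using strict_mono_enumerate[OF inf] by (simp add: strict_mono_def e_def)
  show ?thesis
  proof (rule antisym)
    show "ratio r 1 \<le> trans_ratio r"
      using liminf_subseq_mono[OF mono, of "\<lambda>n. ereal (real (cnt r 1 n) / real (cnt r 0 n))"]
      by (simp add: T ratio_def comp_def cnt0)
    show "trans_ratio r \<le> ratio r 1"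
      unfolding ratio_def le_Liminf_iff
    proof (intro allI impI)
      fix c assume "c < trans_ratio r"
      then have "\<forall>\<^sub>F m in sequentially. c < ereal (real (cnt r 1 (e m)) / real (Suc m))"
        unfolding T by (rule less_LiminfD)
      \<comment> \<open>\<open>cnt r 0 n - 1\<close> is the index of the last input letter read
        before time \<open>n\<close>.\<close>
      moreover have "filterlim (\<lambda>n. cnt r 0 n - 1) at_top sequentially"
        using filterlim_compose[OF filterlim_minus_const_nat_at_top cnt_at_top[OF inf]] .
      ultimately have "\<forall>\<^sub>F n in sequentially.
          c < ereal (real (cnt r 1 (e (cnt r 0 n - 1))) / real (Suc (cnt r 0 n - 1)))"
        by (rule eventually_compose_filterlim)
      moreover have "\<forall>\<^sub>F n in sequentially. 1 \<le> cnt r 0 n"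
        using cnt_at_top[OF inf] unfolding filterlim_at_top by blast
      ultimately show "\<forall>\<^sub>F n in sequentially. c < ereal (real (cnt r 1 n) / real (cnt r 0 n))"
      proof eventually_elim
        case (elim n)
        have "e (cnt r 0 n - 1) \<le> n"
        proof (rule ccontr)
          assume "\<not> ?thesis"
          then have "cnt r 0 n \<le> cnt r 0 (enumerate (tape_pos r 0) (cnt r 0 n - 1))"
            by (intro cnt_mono) (simp add: e_def)
          then show False
            using elim(2) by (simp add: cnt_enumerate[OF inf])
        qed
        then have "cnt r 1 (e (cnt r 0 n - 1)) \<le> cnt r 1 n"
          by (rule cnt_mono)
        then have "real (cnt r 1 (e (cnt r 0 n - 1))) / real (Suc (cnt r 0 n - 1)) \<le>
            real (cnt r 1 n) / real (cnt r 0 n)"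
          using elim(2) by (simp add: divide_right_mono)
        then show ?case
          using elim(1) by (meson ereal_less_eq(3) less_le_trans)
      qed
    qed
  qed
qed

section \<open>The run as a function of the inputs\<close>

definition count_hist :: "(nat \<times> 'a option list \<times> nat) list \<Rightarrow> nat \<Rightarrow> nat" where
  "count_hist h j = length (filter (\<lambda>t. lab t ! j \<noteq> None) h)"

lemma count_hist_run: "count_hist (map r [0..<n]) j = cnt r j n"
  by (induction n) (auto simp: count_hist_def cnt_Suc)

definition step_ok :: "'a kaut \<Rightarrow> nat \<Rightarrow> (nat \<times> 'a option list \<times> nat) list \<Rightarrow> 'a \<Rightarrow> 'a \<Rightarrow>
    nat \<times> 'a option list \<times> nat \<Rightarrow> bool" where
  "step_ok M l h a b t \<longleftrightarrow> t \<in> trans M \<and>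
     (if h = [] then fst t \<in> init M else fst t = snd (snd (last h))) \<and>
     (\<forall>j<l. lab t ! j = None \<or> lab t ! j = Some (if j = 0 then a else b))"

definition next_step where
  "next_step M l h a b = (SOME t. step_ok M l h a b t)"

text \<open>The past is kept as a finite list: over a finite alphabet these lists form a countable
  type, so measurability follows by countable case distinctions.\<close>

primrec hist :: "'a kaut \<Rightarrow> nat \<Rightarrow> (nat \<Rightarrow> 'a) \<Rightarrow> (nat \<Rightarrow> 'a) \<Rightarrow> nat \<Rightarrow>
    (nat \<times> 'a option list \<times> nat) list" where
  "hist M l x y 0 = []"
| "hist M l x y (Suc n) = (let h = hist M l x y n in
     h @ [next_step M l h (x (count_hist h 0)) (y (count_hist h 1))])"

text \<open>The only possible run on given inputs; a junk sequence if there is none.\<close>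

definition canon :: "'a kaut \<Rightarrow> nat \<Rightarrow> (nat \<Rightarrow> 'a) \<Rightarrow> (nat \<Rightarrow> 'a) \<Rightarrow> 'a run" where
  "canon M l x y n = last (hist M l x y (Suc n))"

definition reads :: "'a run \<Rightarrow> nat \<Rightarrow> (nat \<Rightarrow> 'a) \<Rightarrow> (nat \<Rightarrow> 'a) \<Rightarrow> bool" where
  "reads r l x y \<longleftrightarrow> (\<forall>j<l. spells r j (if j = 0 then x else y))"

text \<open>The state fixes which input tapes are read, \<open>a\<close> and \<open>b\<close> fix
  the letters, and determinism fixes outputs and successor. For the empty history the state is the
  single initial one.\<close>

lemma step_ok_unique:
  assumes M: "l_det k l M" and t: "step_ok M l h a b t" and t': "step_ok M l h a b t'"
  shows "t = t'"
proof -
  obtain p u q p' u' q' where eq: "t = (p, u, q)" "t' = (p', u', q')"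
    by (metis prod_cases3)
  obtain q0 where "init M = {q0}"
    using M by (auto simp: l_det_def)
  then have p: "p' = p"
    using t t' by (auto simp: step_ok_def eq split: if_splits)
  have tr: "(p, u, q) \<in> trans M" "(p, u', q') \<in> trans M"
    using t t' p by (auto simp: step_ok_def eq)
  have none: "\<forall>j<l. u ! j = None \<longrightarrow> u' ! j = None" "\<forall>j<l. u' ! j = None \<longrightarrow> u ! j = None"
    and same: "(\<forall>i<l. u ! i = u' ! i) \<Longrightarrow> (\<forall>i. l \<le> i \<and> i < k \<longrightarrow> u ! i = u' ! i) \<and> q = q'"
    using l_detD[OF M tr] l_detD[OF M tr(2,1)] by blast+
  have "u ! i = u' ! i" if "i < l" for i
    using t t' none that by (fastforce simp: step_ok_def eq lab_def)
  then have "q = q'" "\<forall>i<k. u ! i = u' ! i"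
    using same by (auto simp: not_less[symmetric])
  moreover have "length u = k" "length u' = k"
    using M tr unfolding l_det_def is_kaut_def by blast+
  ultimately show ?thesis
    using p by (auto simp: eq intro: nth_equalityI)
qed

text \<open>Each transition of \<open>r\<close> is an admissible step after its own past, hence by
  uniqueness the one chosen by \<open>next_step\<close>.\<close>

lemma canon_eq:
  assumes M: "l_det k l M" "l \<le> 2" and r: "is_run M r" "fst (r 0) \<in> init M" "reads r l x y"
  shows "canon M l x y = r"
proof -
  have "hist M l x y n = map r [0..<n]" for n
  proof (induction n)
    case (Suc n)
    have "step_ok M l (map r [0..<n]) (x (cnt r 0 n)) (y (cnt r 1 n)) (r n)"
      unfolding step_ok_def
    proof (intro conjI allI impI)
      show "r n \<in> trans M"
        using r by (simp add: is_run_def)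
      show "if map r [0..<n] = [] then fst (r n) \<in> init M
          else fst (r n) = snd (snd (last (map r [0..<n])))"
        using r by (cases n) (auto simp: is_run_def)
      show "lab (r n) ! j = None \<or> lab (r n) ! j = Some (if j = 0 then x (cnt r 0 n) else y (cnt r 1 n))"
        if j: "j < l" for j
      proof -
        have "spells r j (if j = 0 then x else y)"
          using r(3) j by (simp add: reads_def)
        then have "lab (r n) ! j = None \<or> lab (r n) ! j = Some ((if j = 0 then x else y) (cnt r j n))"
          by (auto simp: spells_def)
        moreover have "j = 0 \<or> j = 1"
          using j M(2) by linarith
        ultimately show ?thesis by auto
      qed
    qed
    then have "next_step M l (map r [0..<n]) (x (cnt r 0 n)) (y (cnt r 1 n)) = r n"
      unfolding next_step_def using step_ok_unique[OF M(1)] by blast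
    then show ?case
      by (simp add: Suc count_hist_run)
  qed simp
  then show ?thesis
    by (simp add: fun_eq_iff canon_def del: hist.simps)
qed

section \<open>Measurability of random runs\<close>

lemma measurable_letters [measurable]:
  "(\<lambda>\<omega>. fst \<omega> i) \<in> unif_words \<Otimes>\<^sub>M unif_words \<rightarrow>\<^sub>M count_space (UNIV :: 'a::finite set)"
  "(\<lambda>\<omega>. snd \<omega> i) \<in> unif_words \<Otimes>\<^sub>M unif_words \<rightarrow>\<^sub>M count_space (UNIV :: 'a::finite set)"
  using measurable_compose[OF measurable_fst measurable_letter[of i]]
    measurable_compose[OF measurable_snd measurable_letter[of i]] by auto

abbreviation words2 :: "((nat \<Rightarrow> 'a::finite) \<times> (nat \<Rightarrow> 'a)) measure" where
  "words2 \<equiv> unif_words \<Otimes>\<^sub>M unif_words"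

lemma measurable_countable2:
  fixes g :: "'b \<Rightarrow> 'c::countable" and h :: "'b \<Rightarrow> 'd::countable"
  assumes "g \<in> M \<rightarrow>\<^sub>M count_space UNIV" "h \<in> M \<rightarrow>\<^sub>M count_space UNIV"
  shows "(\<lambda>\<omega>. f (g \<omega>) (h \<omega>)) \<in> M \<rightarrow>\<^sub>M count_space UNIV"
proof (rule measurable_compose_countable[OF _ assms(1)])
  show "(\<lambda>\<omega>. f i (h \<omega>)) \<in> M \<rightarrow>\<^sub>M count_space UNIV" for i
    by (rule measurable_compose[OF assms(2)]) simp
qed

lemma measurable_hist:
  fixes M :: "'a::finite kaut"
  shows "(\<lambda>\<omega>. hist M l (fst \<omega>) (snd \<omega>) n) \<in> words2 \<rightarrow>\<^sub>M count_space UNIV"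
proof (induction n)
  case (Suc n)
  show ?case
    unfolding hist.simps Let_def
  proof (rule measurable_compose_countable[OF _ Suc, of "\<lambda>h \<omega>. h @ [next_step M l h
      (fst \<omega> (count_hist h 0)) (snd \<omega> (count_hist h 1))]"])
    show "(\<lambda>\<omega>. h @ [next_step M l h (fst \<omega> (count_hist h 0)) (snd \<omega> (count_hist h 1))])
        \<in> words2 \<rightarrow>\<^sub>M count_space UNIV" for h
      using measurable_countable2[OF measurable_letters(1)[of "count_hist h 0"] measurable_letters(2)[of "count_hist h 1"],
          of "\<lambda>a b. h @ [next_step M l h a b]"] .
  qed
qed simp

lemma measurable_canon:
  fixes M :: "'a::finite kaut"
  shows "(\<lambda>\<omega>. canon M l (fst \<omega>) (snd \<omega>) n) \<in> words2 \<rightarrow>\<^sub>M count_space UNIV"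
  unfolding canon_def by (rule measurable_compose[OF measurable_hist]) simp

context
  fixes R :: "'b \<Rightarrow> ('a::finite) run" and N :: "'b measure"
  assumes R: "\<And>n. (\<lambda>\<omega>. R \<omega> n) \<in> N \<rightarrow>\<^sub>M count_space UNIV"
begin

lemma pred_run: "Measurable.pred N (\<lambda>\<omega>. Q (R \<omega> i))"
  by (rule measurable_compose[OF R]) simp

lemma measurable_cnt: "(\<lambda>\<omega>. cnt (R \<omega>) j n) \<in> N \<rightarrow>\<^sub>M count_space UNIV"
proof (induction n)
  case (Suc n)
  show ?case
    unfolding cnt_Suc
    by (rule measurable_countable2[OF Suc R[of n], of "\<lambda>m t. m + (if lab t ! j = None then 0 else 1)"])
qed simp

lemma measurable_ratio: "(\<lambda>\<omega>. ratio (R \<omega>) j) \<in> borel_measurable N"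
proof -
  have [measurable]: "(\<lambda>\<omega>. real (cnt (R \<omega>) j n)) \<in> borel_measurable N" for j n
    by (rule measurable_compose[OF measurable_cnt]) simp
  show ?thesis
    unfolding ratio_def by measurable
qed

lemma pred_accepting: "Measurable.pred N (\<lambda>\<omega>. accepting k M (R \<omega>))"
proof -
  have [measurable]: "Measurable.pred N (\<lambda>\<omega>. R \<omega> i \<in> trans M \<and> snd (snd (R \<omega> i)) = fst (R \<omega> (Suc i)))" for i
    by (rule measurable_countable2[OF R R, of "\<lambda>t t'. t \<in> trans M \<and> snd (snd t) = fst t'"])
  have [measurable]: "Measurable.pred N (\<lambda>\<omega>. fst (R \<omega> 0) \<in> init M)"
    by (rule pred_run)
  have [measurable]: "Measurable.pred N (\<lambda>\<omega>. lab (R \<omega> i) ! j \<noteq> None)" for i j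
    by (rule pred_run)
  show ?thesis
    unfolding accepting_def is_run_def infinite_nat_iff_unbounded tape_pos_def mem_Collect_eq
    by measurable
qed

lemma pred_spells:
  assumes X: "\<And>n. (\<lambda>\<omega>. X \<omega> n) \<in> N \<rightarrow>\<^sub>M count_space UNIV"
  shows "Measurable.pred N (\<lambda>\<omega>. spells (R \<omega>) j (X \<omega>))"
proof -
  have X_cnt: "(\<lambda>\<omega>. X \<omega> (cnt (R \<omega>) j i)) \<in> N \<rightarrow>\<^sub>M count_space UNIV" for i
    by (rule measurable_compose_countable[OF X measurable_cnt])
  have "Measurable.pred N (\<lambda>\<omega>. lab (R \<omega> i) ! j \<noteq> None \<longrightarrow>
      lab (R \<omega> i) ! j = Some (X \<omega> (cnt (R \<omega>) j i)))" for i
    by (rule measurable_countable2[OF R X_cnt, of "\<lambda>t a. lab t ! j \<noteq> None \<longrightarrow> lab t ! j = Some a"])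
  then show ?thesis
    unfolding spells_def by (rule pred_intros_countable)
qed

end

text \<open>Determinism leaves at most one run per automaton; the default \<open>\<top>\<close> for
  inputs without an accepting run is neutral for infima.\<close>

definition best_ratio :: "nat \<Rightarrow> nat \<Rightarrow> 'a kaut \<Rightarrow> (nat \<Rightarrow> 'a) \<Rightarrow> (nat \<Rightarrow> 'a) \<Rightarrow> ereal" where
  "best_ratio k l M x y = (let r = canon M l x y in
     if accepting k M r \<and> reads r l x y then ratio r l else \<top>)"

lemma measurable_best_ratio:
  fixes M :: "'a::finite kaut"
  shows "(\<lambda>\<omega>. best_ratio k l M (fst \<omega>) (snd \<omega>)) \<in> borel_measurable words2"
proof -
  have [measurable]: "Measurable.pred words2
      (\<lambda>\<omega>. spells (canon M l (fst \<omega>) (snd \<omega>)) j (if j = 0 then fst \<omega> else snd \<omega>))" for j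
    by (intro pred_spells measurable_canon) (auto simp: measurable_letters)
  note [measurable] = pred_accepting[OF measurable_canon] measurable_ratio[OF measurable_canon]
  show ?thesis
    unfolding best_ratio_def Let_def reads_def by measurable
qed

section \<open>Infima over countably many automata\<close>

lemma countable_kaut: "countable {M :: 'a::finite kaut. is_kaut k M}"
proof -
  let ?f = "\<lambda>M :: 'a kaut. (states M, trans M, init M)"
  \<comment> \<open>Finitely many states and labels of fixed length over a finite alphabet leave
    only finitely many transitions.\<close>
  have "?f ` {M. is_kaut k M} \<subseteq> Collect finite \<times> Collect finite \<times> Collect finite"
  proof safe
    fix M :: "'a kaut" assume M: "is_kaut k M"
    then show fin: "finite (states M)" and "finite (init M)"
      by (auto simp: is_kaut_def intro: finite_subset)
    have "trans M \<subseteq> states M \<times> {u. set u \<subseteq> UNIV \<and> length u = k} \<times> states M"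
      using M by (auto simp: is_kaut_def)
    then show "finite (trans M)"
      by (rule finite_subset) (intro finite_cartesian_product fin finite_lists_length_eq finite)
  qed
  then have "countable (?f ` {M. is_kaut k M})"
    by (rule countable_subset) (intro countable_SIGMA countable_Collect_finite)
  moreover have "inj_on ?f {M. is_kaut k M}"
    by (auto intro: inj_onI)
  ultimately show ?thesis
    by (rule countable_image_inj_on)
qed

lemma countable_one_to_one: "countable {T :: 'a::finite kaut. one_to_one T}"
  by (rule countable_subset[OF _ countable_kaut[of 2]]) (auto simp: one_to_one_def l_det_def)

lemma countable_compressor: "countable {C :: 'a::finite kaut. compressor C}"
  by (rule countable_subset[OF _ countable_kaut[of 3]]) (auto simp: compressor_def l_det_def)

text \<open>Identifying each run with the canonical one turns an infimum over runs into one over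
  automata.\<close>

lemma Inf_runs_eq:
  assumes "l \<le> 2" "\<And>M. P M \<Longrightarrow> l_det k l M"
  shows "Inf {ratio r l | M r. P M \<and> accepting k M r \<and> reads r l x y} = (INF M\<in>Collect P. best_ratio k l M x y)"
proof (rule antisym)
  show "Inf {ratio r l | M r. P M \<and> accepting k M r \<and> reads r l x y} \<le> (INF M\<in>Collect P. best_ratio k l M x y)"
    by (rule INF_greatest) (auto simp: best_ratio_def Let_def intro!: Inf_lower)
  show "(INF M\<in>Collect P. best_ratio k l M x y) \<le> Inf {ratio r l | M r. P M \<and> accepting k M r \<and> reads r l x y}"
  proof (rule Inf_greatest, clarify)
    fix M r assume r: "P M" "accepting k M r" "reads r l x y"
    then have "canon M l x y = r"
      using assms by (intro canon_eq) (auto simp: accepting_def)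
    then have "best_ratio k l M x y = ratio r l"
      using r by (simp add: best_ratio_def)
    then show "(INF M\<in>Collect P. best_ratio k l M x y) \<le> ratio r l"
      using r by (metis INF_lower mem_Collect_eq)
  qed
qed

text \<open>Valid for every \<open>y\<close>, as tape 0 is the only input; this form lets
  \<open>rho\<close> be treated over pairs like \<open>rho_cond\<close>.\<close>

lemma rho_eq: "rho x = (INF T\<in>{T. one_to_one T}. best_ratio 2 1 T x y)"
proof -
  have "accepting 2 T r \<Longrightarrow> (reads r 1 x y \<longleftrightarrow> tape r 0 = x) \<and> trans_ratio r = ratio r 1" for T r
    by (simp add: accepting_def trans_ratio_eq tape_eq_iff_spells reads_def)
  then have "{trans_ratio r | T r. one_to_one T \<and> accepting 2 T r \<and> tape r 0 = x} =
      {ratio r 1 | T r. one_to_one T \<and> accepting 2 T r \<and> reads r 1 x y}"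
    by (intro Collect_cong ex_cong1) metis
  then show ?thesis
    unfolding rho_def by (simp only:) (intro Inf_runs_eq, auto simp: one_to_one_def)
qed

lemma rho_cond_eq: "rho_cond x y = (INF C\<in>{C. compressor C}. best_ratio 3 2 C x y)"
proof -
  have "accepting 3 C r \<Longrightarrow> reads r 2 x y \<longleftrightarrow> tape r 0 = x \<and> tape r 1 = y" for C r
    by (auto simp: accepting_def tape_eq_iff_spells reads_def less_2_cases_iff)
  then have "{comp_ratio r | C r. compressor C \<and> accepting 3 C r \<and> tape r 0 = x \<and> tape r 1 = y} =
      {ratio r 2 | C r. compressor C \<and> accepting 3 C r \<and> reads r 2 x y}"
    unfolding comp_ratio_eq by blast
  then show ?thesis
    unfolding rho_cond_def by (simp only:) (intro Inf_runs_eq, auto simp: compressor_def)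
qed

lemma measurable_rho_cond [measurable]:
  "(\<lambda>\<omega>. rho_cond (fst \<omega>) (snd \<omega>)) \<in> borel_measurable (words2 :: (_ \<times> (nat \<Rightarrow> 'a::finite)) measure)"
  unfolding rho_cond_eq
  by (intro borel_measurable_INF countable_compressor measurable_best_ratio)

lemma measurable_rho [measurable]:
  "(\<lambda>\<omega>. rho (fst \<omega>)) \<in> borel_measurable (words2 :: (_ \<times> (nat \<Rightarrow> 'a::finite)) measure)"
proof -
  have "(\<lambda>\<omega> :: _ \<times> (nat \<Rightarrow> 'a). rho (fst \<omega>)) =
      (\<lambda>\<omega>. INF T\<in>{T. one_to_one T}. best_ratio 2 1 T (fst \<omega>) (snd \<omega>))"
    by (intro ext rho_eq)
  also have "\<dots> \<in> borel_measurable words2"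
    by (intro borel_measurable_INF countable_one_to_one measurable_best_ratio)
  finally show ?thesis .
qed

lemma measurable_rho_swap [measurable]:
  "(\<lambda>\<omega>. rho_cond (snd \<omega>) (fst \<omega>)) \<in> borel_measurable (words2 :: (_ \<times> (nat \<Rightarrow> 'a::finite)) measure)"
  "(\<lambda>\<omega>. rho (snd \<omega>)) \<in> borel_measurable (words2 :: (_ \<times> (nat \<Rightarrow> 'a::finite)) measure)"
  using measurable_compose[OF measurable_pair_swap' measurable_rho_cond]
    measurable_compose[OF measurable_pair_swap' measurable_rho]
  by (auto simp: case_prod_beta)

subsection \<open>Comparison of the two ratios\<close>

definition copier :: "'a kaut" where
  "copier = \<lparr>states = {0}, trans = {(0, [Some a, Some a], 0) | a. True}, init = {0}\<rparr>"

lemma one_to_one_copier: "one_to_one copier"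
  unfolding one_to_one_def
proof (intro conjI allI impI)
  show "l_det 2 1 copier"
    by (auto simp: l_det_def is_kaut_def copier_def less_Suc_eq)
  have "x = y" if "trans_out copier x y" for x y :: "nat \<Rightarrow> 'a"
  proof -
    obtain r where r: "accepting 2 copier r" "tape r 0 = x" "tape r 1 = y"
      using \<open>trans_out copier x y\<close> by (auto simp: trans_out_def)
    have "lab (r i) ! 0 = lab (r i) ! 1" for i
    proof -
      have "r i \<in> trans copier"
        using r by (simp add: accepting_def is_run_def)
      then show ?thesis by (auto simp: copier_def lab_def)
    qed
    then have "tape r 0 = tape r 1"
      by (simp add: tape_def tape_pos_def)
    then show ?thesis using r by simp
  qed
  then show "x = x'" if "trans_out copier x y \<and> trans_out copier x' y" for x x' y :: "nat \<Rightarrow> 'a"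
    using that by metis
qed

lemma cnt_eq_self: "tape_pos r j = UNIV \<Longrightarrow> cnt r j n = n"
  by (simp add: cnt_eq_tape_pos)

lemma rho_le_1: "rho x \<le> 1"
proof -
  define r :: "'a run" where "r i = (0, [Some (x i), Some (x i)], 0)" for i
  have pos: "tape_pos r 0 = UNIV" "tape_pos r 1 = UNIV"
    by (auto simp: r_def tape_pos_def lab_def)
  have acc: "accepting 2 copier r"
    using pos by (auto simp: accepting_def is_run_def copier_def less_2_cases_iff) (auto simp: r_def)
  have "spells r 0 x"
    unfolding spells_def using cnt_eq_self[OF pos(1)] by (simp add: r_def lab_def)
  then have tape: "tape r 0 = x"
    using pos by (simp add: tape_eq_iff_spells)
  \<comment> \<open>The quotient is 1 from \<open>n = 1\<close> on; at \<open>n = 0\<close> it is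
    \<open>0 / 0 = 0\<close>.\<close>
  have "ratio r 1 = liminf (\<lambda>n. ereal 1)"
    unfolding ratio_def cnt_eq_self[OF pos(1)] cnt_eq_self[OF pos(2)]
    by (intro Liminf_eq eventually_sequentiallyI[of 1]) auto
  then have "trans_ratio r = 1"
    using pos by (simp add: trans_ratio_eq Liminf_const one_ereal_def)
  then show ?thesis
    unfolding rho_def using one_to_one_copier acc tape by (auto intro!: Inf_lower2)
qed

text \<open>Every transition consumes one oracle letter, whatever it is, so the oracle tape is read
  infinitely often, as acceptance demands; the output moves to tape 2.\<close>

definition with_oracle :: "'a kaut \<Rightarrow> 'a kaut" where
  "with_oracle T = \<lparr>states = states T,
     trans = {(p, [a ! 0, Some b, a ! 1], q) | p a q b. (p, a, q) \<in> trans T}, init = init T\<rparr>"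

lemma trans_with_oracle:
  "(p, a, q) \<in> trans (with_oracle T) \<longleftrightarrow> (\<exists>u b. a = [u ! 0, Some b, u ! 1] \<and> (p, u, q) \<in> trans T)"
  unfolding with_oracle_def by simp

text \<open>Erasing the oracle letters yields a run of \<open>T\<close> with the same input and
  output, so injectivity is inherited for every oracle.\<close>

lemma compressor_with_oracle:
  assumes T: "one_to_one T"
  shows "compressor (with_oracle T)"
  unfolding compressor_def
proof (intro conjI allI impI)
  have det: "l_det 2 1 T"
    using T by (simp add: one_to_one_def)
  then have len: "length a = 2" if "(p, a, q) \<in> trans T" for p a q
    using that unfolding l_det_def is_kaut_def by blast
  show "l_det 3 2 (with_oracle T)"
    unfolding l_det_def
  proof (intro conjI allI impI)
    have "is_kaut 2 T" "\<exists>q. init T = {q}"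
      using det unfolding l_det_def by blast+
    then show "is_kaut 3 (with_oracle T)" "\<exists>q. init (with_oracle T) = {q}"
      unfolding is_kaut_def with_oracle_def by auto
  next
    fix p a q a' q' j
    assume tr: "(p, a, q) \<in> trans (with_oracle T)" "(p, a', q') \<in> trans (with_oracle T)"
    then obtain u b u' b' where u: "a = [u ! 0, Some b, u ! 1]" "a' = [u' ! 0, Some b', u' ! 1]"
      "(p, u, q) \<in> trans T" "(p, u', q') \<in> trans T"
      unfolding trans_with_oracle by blast
    have *: "u ! 0 = None \<longrightarrow> u' ! 0 = None"
      "u ! 0 = u' ! 0 \<longrightarrow> u ! 1 = u' ! 1 \<and> q = q'"
    proof -
      note D = l_detD[OF det u(3,4)]
      show "u ! 0 = None \<longrightarrow> u' ! 0 = None"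
        using conjunct1[OF D] by simp
      show "u ! 0 = u' ! 0 \<longrightarrow> u ! 1 = u' ! 1 \<and> q = q'"
      proof
        assume "u ! 0 = u' ! 0"
        then have "\<forall>i<1. u ! i = u' ! i" by simp
        with D have "\<forall>i. 1 \<le> i \<and> i < 2 \<longrightarrow> u ! i = u' ! i" and "q = q'"
          by blast+
        from this(1)[rule_format, of 1] this(2) show "u ! 1 = u' ! 1 \<and> q = q'"
          by simp
      qed
    qed
    show "j < 2 \<Longrightarrow> a ! j = None \<Longrightarrow> a' ! j = None"
      using * u(1,2) by (auto simp: less_2_cases_iff)
    assume "\<forall>i<2. a ! i = a' ! i"
    then have "a ! 0 = a' ! 0" by simp
    then have "u ! 0 = u' ! 0"
      unfolding u(1,2) by simp
    then have same: "u ! 1 = u' ! 1 \<and> q = q'"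
      using * by simp
    then show "q = q'" by simp
    assume "2 \<le> j \<and> j < 3"
    then have "j = 2" by simp
    then show "a ! j = a' ! j"
      unfolding u(1,2) using same by simp
  qed
  have "trans_out T x z" if "comp_out (with_oracle T) x y z" for x y z
  proof -
    obtain r where r: "accepting 3 (with_oracle T) r" "tape r 0 = x" "tape r 2 = z"
      using \<open>comp_out (with_oracle T) x y z\<close> by (auto simp: comp_out_def)
    define r' where "r' i = (fst (r i), [lab (r i) ! 0, lab (r i) ! 2], snd (snd (r i)))" for i
    have lab': "lab (r' i) ! 0 = lab (r i) ! 0" "lab (r' i) ! 1 = lab (r i) ! 2" for i
      by (simp_all add: r'_def lab_def)
    have "r' i \<in> trans T" for i
    proof -
      have "r i \<in> trans (with_oracle T)"
        using r by (simp add: accepting_def is_run_def)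
      then have "(fst (r i), lab (r i), snd (snd (r i))) \<in> trans (with_oracle T)"
        by (simp add: lab_def)
      then obtain a b where a: "lab (r i) = [a ! 0, Some b, a ! 1]" "(fst (r i), a, snd (snd (r i))) \<in> trans T"
        unfolding trans_with_oracle by blast
      moreover have "a = [a ! 0, a ! 1]"
        using len[OF a(2)] by (auto simp: numeral_2_eq_2 length_Suc_conv)
      ultimately show ?thesis
        by (simp add: r'_def lab_def)
    qed
    then have "is_run T r'"
      using r by (simp add: accepting_def is_run_def r'_def)
    moreover have "tape_pos r' 0 = tape_pos r 0" "tape_pos r' 1 = tape_pos r 2"
      by (simp_all only: tape_pos_def lab')
    moreover from this have "tape r' 0 = tape r 0" "tape r' 1 = tape r 2"
      by (simp_all only: tape_def lab')
    moreover have "fst (r' 0) \<in> init T"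
      using r by (simp add: accepting_def r'_def with_oracle_def)
    ultimately have "accepting 2 T r'" "tape r' 0 = x" "tape r' 1 = z"
      using r by (auto simp: accepting_def less_2_cases_iff)
    then show ?thesis
      by (auto simp: trans_out_def)
  qed
  then show "x = x'" if "comp_out (with_oracle T) x y z \<and> comp_out (with_oracle T) x' y z" for x x' y z
    using that T unfolding one_to_one_def by blast
qed

text \<open>Adding the oracle letter \<open>y i\<close> to transition \<open>i\<close> of a run of
  \<open>T\<close> gives a run of \<open>with_oracle T\<close> with the same ratio.\<close>

lemma rho_cond_le_rho: "rho_cond x y \<le> rho x"
  unfolding rho_def
proof (rule Inf_greatest)
  fix c assume "c \<in> {trans_ratio r | T r. one_to_one T \<and> accepting 2 T r \<and> tape r 0 = x}"
  then obtain T r where c: "c = trans_ratio r" and T: "one_to_one T" and r: "accepting 2 T r"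
    and x: "x = tape r 0"
    by blast
  define r' where "r' i = (fst (r i), [lab (r i) ! 0, Some (y i), lab (r i) ! 1], snd (snd (r i)))" for i
  have lab': "lab (r' i) ! 0 = lab (r i) ! 0" "lab (r' i) ! 1 = Some (y i)" "lab (r' i) ! 2 = lab (r i) ! 1" for i
    by (simp_all add: r'_def lab_def)
  have pos: "tape_pos r' 0 = tape_pos r 0" "tape_pos r' 1 = UNIV" "tape_pos r' 2 = tape_pos r 1"
    by (auto simp only: tape_pos_def lab')
  have "tape r' 0 = x"
    by (simp only: tape_def lab' pos x)
  moreover have "tape r' 1 = y"
    using pos lab' cnt_eq_self[OF pos(2)] by (simp add: tape_eq_iff_spells spells_def)
  moreover have "accepting 3 (with_oracle T) r'"
  proof -
    have "r' i \<in> trans (with_oracle T)" for i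
    proof -
      have "r i \<in> trans T"
        using r by (simp add: accepting_def is_run_def)
      then have "(fst (r i), lab (r i), snd (snd (r i))) \<in> trans T"
        by (simp add: lab_def)
      then show ?thesis
        unfolding with_oracle_def r'_def by auto
    qed
    then have "is_run (with_oracle T) r'"
      using r by (simp add: accepting_def is_run_def r'_def)
    moreover have "fst (r' 0) \<in> init (with_oracle T)"
      using r by (simp add: accepting_def r'_def with_oracle_def)
    moreover have "infinite (tape_pos r' j)" if "j < 3" for j
    proof -
      have "j = 0 \<or> j = 1 \<or> j = 2" using that by linarith
      then show ?thesis using r pos by (auto simp: accepting_def)
    qed
    ultimately show ?thesis
      by (simp add: accepting_def)
  qed
  moreover have "comp_ratio r' = trans_ratio r"
    using r by (simp add: comp_ratio_eq trans_ratio_eq accepting_def ratio_def cnt_eq_tape_pos pos)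
  ultimately show "rho_cond x y \<le> c"
    unfolding c rho_cond_def using compressor_with_oracle[OF T]
    by (intro Inf_lower CollectI exI[of _ "with_oracle T"] exI[of _ r']) simp
qed

section \<open>Almost sure independence\<close>

lemma AE_rho_cond_ge_1:
  assumes "CARD('a::finite) \<ge> 2"
  shows "AE y in unif_words. AE x in unif_words. 1 \<le> rho_cond x (y :: nat \<Rightarrow> 'a)"
proof -
  \<comment> \<open>There are only countably many compressors, so one null set serves them
    all.\<close>
  have "AE y in unif_words. \<forall>C\<in>{C :: 'a kaut. compressor C}. AE x in unif_words.
      \<forall>r. computes C r x y \<longrightarrow> 1 \<le> comp_ratio r"
    by (subst AE_ball_countable[OF countable_compressor])
      (auto intro: AE_compressor_ratio_ge_1 assms)
  then show ?thesis
  proof eventually_elim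
    case (elim y)
    then have "AE x in unif_words. \<forall>C\<in>{C :: 'a kaut. compressor C}. \<forall>r. computes C r x y \<longrightarrow> 1 \<le> comp_ratio r"
      by (subst AE_ball_countable[OF countable_compressor])
    then show ?case
      by eventually_elim (auto simp: rho_cond_def computes_def intro!: Inf_greatest)
  qed
qed

text \<open>Squeezing: \<open>1 \<le> rho_cond x y \<le> rho x \<le> 1\<close>, and likewise with
  \<open>x\<close> and \<open>y\<close> exchanged.\<close>

lemma fs_independent_if:
  assumes "1 \<le> rho_cond x y" "1 \<le> rho_cond y x"
  shows "fs_independent x y"
proof -
  have "rho_cond x y = 1" "rho x = 1" "rho_cond y x = 1" "rho y = 1"
    using assms rho_cond_le_rho[of x y] rho_cond_le_rho[of y x] rho_le_1[of x] rho_le_1[of y]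
    by (meson antisym order_trans)+
  then show ?thesis
    by (simp add: fs_independent_def)
qed

theorem theorem16:
  assumes "CARD('a::finite) \<ge> 2"
  shows "emeasure (unif_words \<Otimes>\<^sub>M unif_words)
           {(x :: nat \<Rightarrow> 'a, y). fs_independent x y} = 1"
proof -
  interpret pair_prob_space "unif_words :: (nat \<Rightarrow> 'a) measure" "unif_words :: (nat \<Rightarrow> 'a) measure" ..
  \<comment> \<open>Measurability matters for the value itself: \<open>emeasure\<close> is 0 on
    non-measurable sets.\<close>
  have [measurable]: "Measurable.pred words2 (\<lambda>\<omega> :: _ \<times> (nat \<Rightarrow> 'a). fs_independent (fst \<omega>) (snd \<omega>))"
    unfolding fs_independent_def by measurable
  have ae: "AE y in unif_words. AE x in unif_words. 1 \<le> rho_cond x (y :: nat \<Rightarrow> 'a)"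
    using assms by (rule AE_rho_cond_ge_1)
  \<comment> \<open>The oracle is the first component here, which matches the quantifier order of
    \<open>ae\<close>.\<close>
  have "AE \<omega> in words2. 1 \<le> rho_cond (snd \<omega>) (fst \<omega> :: nat \<Rightarrow> 'a)"
    using ae by (intro AE_pair_measure) auto
  \<comment> \<open>The oracle is now the second component, so the two almost-everywhere quantifiers
    must be exchanged.\<close>
  moreover have "AE \<omega> in words2. 1 \<le> rho_cond (fst \<omega>) (snd \<omega> :: nat \<Rightarrow> 'a)"
    using ae by (intro AE_pair_measure, measurable) (subst AE_commute, auto)
  ultimately have "AE \<omega> in words2. fs_independent (fst \<omega>) (snd \<omega> :: nat \<Rightarrow> 'a)"
    by eventually_elim (rule fs_independent_if)
  then have "emeasure words2 {\<omega> \<in> space words2. fs_independent (fst \<omega>) (snd \<omega> :: nat \<Rightarrow> 'a)} = 1"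
    by (intro P.emeasure_eq_1_AE) auto
  then show ?thesis
    by (simp add: case_prod_beta' space_pair_measure)
qed

end
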